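(* Let $\ell\ge0$. Suppose $\psi\in L^1(\mathbb{R}^n)$ satisfies the Tauberian condition, with $\widehat\psi\in C^{n+1+[\ell]}(\mathbb{R}^n\setminus\{0\})$. Then there exist $\eta,\phi$ with $\widehat\eta,\widehat\phi\in C^{n+1+[\ell]}(\mathbb{R}^n)$ such that for every $g\in L^1_{loc}(\mathbb{R}^n)$ with $g(x)=\mathcal{O}(|x|^\ell)$ we have, for every $k\in\mathbb{Z}$ and a.e. $x\in\mathbb{R}^n$, $$g(x)=\phi_k*g(x)+\sum_{j=k+1}^\infty\eta_j*\psi_j*g(x).$$ Moreover $\operatorname{supp}\widehat\phi$ is compact, and $\operatorname{supp}\widehat\eta$ is contained in some annulus $\{a\le|\xi|\le b\}$, $0<a<b<\infty$, about the origin.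
   Context: $[\ell]$ is the integer part of $\ell$. For an integer index $j$, $h_j(x)=2^{jn}h(2^jx)$. $g=\mathcal{O}(|x|^\ell)$ is meant as $|x|\to\infty$. The triple convolution is $\eta_j*\psi_j*g=(\eta_j*\psi_j)*g$. Tauberian condition: for every $\xi\in\mathbb{S}^{n-1}$ there exist $a,b\in\mathbb{R}$ (depending on $\xi$) with $0<2a\le b$ such that $|\widehat\psi(t\xi)|>0$ for every $a\le t\le b$. *)

theory Defs
  imports "HOL-Analysis.Analysis"
begin

definition fourier :: "(real ^ 'n \<Rightarrow> complex) \<Rightarrow> real ^ 'n \<Rightarrow> complex" where
  "fourier f \<xi> = (LINT x|lebesgue. f x * exp (- (2 * of_real pi * \<i> * of_real (x \<bullet> \<xi>))))"

text \<open>The class \<open>C\<^sup>k(S)\<close>. It is only meant for open \<open>S\<close>, since the derivatives are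
  those of \<open>f\<close> in a full neighbourhood of each point.\<close>

primrec Ck_on :: "nat \<Rightarrow> 'a::euclidean_space set \<Rightarrow> ('a \<Rightarrow> 'b::real_normed_vector) \<Rightarrow> bool" where
  "Ck_on 0 S f \<longleftrightarrow> continuous_on S f"
| "Ck_on (Suc k) S f \<longleftrightarrow>
     (\<forall>x\<in>S. f differentiable (at x)) \<and>
     (\<forall>v. Ck_on k S (\<lambda>x. frechet_derivative f (at x) v))"

definition fun_support :: "('a::topological_space \<Rightarrow> 'b::zero) \<Rightarrow> 'a set" where
  "fun_support f = closure {x. f x \<noteq> 0}"

definition tauberian :: "(real ^ 'n \<Rightarrow> complex) \<Rightarrow> bool" where
  "tauberian \<psi> \<longleftrightarrow>
     (\<forall>\<xi>\<in>sphere 0 1. \<exists>a b::real. 0 < 2 * a \<and> 2 * a \<le> b \<and>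
        (\<forall>t\<in>{a..b}. cmod (fourier \<psi> (t *\<^sub>R \<xi>)) > 0))"

definition dilate :: "int \<Rightarrow> (real ^ 'n \<Rightarrow> complex) \<Rightarrow> real ^ 'n \<Rightarrow> complex" where
  "dilate j h x = (2 powi (j * int CARD('n)) :: real) *\<^sub>R h ((2 powi j :: real) *\<^sub>R x)"

text \<open>The Bochner integral of a non-integrable function is \<open>0\<close>, so the value of \<open>conv\<close> is
  meaningful at \<open>x\<close> only if \<open>conv_defined\<close> holds there.\<close>

definition conv_defined :: "(real ^ 'n \<Rightarrow> complex) \<Rightarrow> (real ^ 'n \<Rightarrow> complex) \<Rightarrow> real ^ 'n \<Rightarrow> bool" where
  "conv_defined f g x \<longleftrightarrow> integrable lebesgue (\<lambda>y. f (x - y) * g y)"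

definition conv :: "(real ^ 'n \<Rightarrow> complex) \<Rightarrow> (real ^ 'n \<Rightarrow> complex) \<Rightarrow> real ^ 'n \<Rightarrow> complex" where
  "conv f g x = (LINT y|lebesgue. f (x - y) * g y)"

definition locally_L1 :: "(real ^ 'n \<Rightarrow> complex) \<Rightarrow> bool" where
  "locally_L1 g \<longleftrightarrow> (\<forall>K. compact K \<longrightarrow> g absolutely_integrable_on K)"

text \<open>\<open>g(x) = O(|x|\<^sup>l)\<close> as \<open>|x| \<rightarrow> \<infinity>\<close>, for a function \<open>g\<close> that is determined only up to
  null sets; hence an almost-everywhere bound instead of the pointwise Landau symbol.\<close>

definition growth_bigo :: "real \<Rightarrow> (real ^ 'n \<Rightarrow> complex) \<Rightarrow> bool" where
  "growth_bigo l g \<longleftrightarrow>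
     (\<exists>C R. AE x in lebesgue. norm x \<ge> R \<longrightarrow> cmod (g x) \<le> C * norm x powr l)"

end

theory Submission
  imports Defs "HOL-Probability.Characteristic_Functions"
begin

text \<open>
  Write \<open>m\<close> for the Fourier transform of \<open>\<psi>\<close> and \<open>n\<close> for the dimension. The formula is a telescoping
  sum. Suppose that \<open>f\<phi>\<close> has compact support and equals \<open>1\<close> near the origin, that \<open>f\<eta>\<close> lives on an
  annulus, and that \<open>f\<eta> \<xi> * m \<xi> = f\<phi> \<xi> - f\<phi> (2 \<xi>)\<close>. If \<open>\<eta>\<close> and \<open>\<phi>\<close> are the inverse Fourier transforms of
  \<open>f\<eta>\<close> and \<open>f\<phi>\<close>, then \<open>\<eta>\<^sub>j * \<psi>\<^sub>j = \<phi>\<^sub>j - \<phi>\<^sub>j\<^sub>-\<^sub>1\<close>, the sum over \<open>k < j \<le> M\<close> collapses to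
  \<open>\<phi>\<^sub>M * g - \<phi>\<^sub>k * g\<close>, and all that remains is that \<open>\<phi>\<^sub>M * g\<close> tends to \<open>g\<close> almost everywhere.

  The multipliers come from the Tauberian condition. Along each ray, \<open>m\<close> is nonzero on a segment
  that is long enough to contain a point of every dyadic orbit; by compactness of \<open>1 \<le> |\<xi>| \<le> 2\<close> every dyadic
  orbit meets one fixed annulus at a point where \<open>m\<close> is nonzero (\<open>tauberian_annulus\<close>). Take a
  bump \<open>\<chi>\<close> that is positive on this annulus and let \<open>w = \<chi> |m|\<^sup>2\<close>. The sum \<open>S \<xi>\<close> of \<open>w\<close> over the dyadic
  orbit of \<open>\<xi>\<close> is positive and does not change when \<open>\<xi>\<close> is doubled. Hence \<open>f\<eta> = \<chi> cnj m / S\<close> and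
  \<open>f\<phi> \<xi> = (\<Sum>i\<ge>0. w (2\<^sup>i \<xi>)) / S \<xi>\<close> satisfy the identity (\<open>tauberian_resolution\<close>). The sums are locally
  finite, and \<open>f\<phi>\<close> is \<open>1\<close> near the origin, so both are as smooth as \<open>m\<close> is away from the origin.

  With \<open>N = n + 1 + \<lfloor>l\<rfloor>\<close> derivatives available, the inverse transforms are \<open>O((1 + |x|)\<^sup>-\<^sup>N)\<close>
  (\<open>fourier_decay\<close>). Since \<open>N > n\<close> they are integrable, so the Fourier transform takes them back to \<open>f\<eta>\<close> and
  \<open>f\<phi>\<close> (\<open>fourier_inversion\<close>). Since \<open>N > n + l\<close> they can be integrated against \<open>g\<close>. At a
  Lebesgue point of \<open>g\<close> (almost every point, \<open>AE_lebesgue_point\<close>) the mean oscillation of \<open>g\<close> over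
  balls is small for small radii and grows slower than the power \<open>N - n\<close> of the radius for large ones.
  Cutting the kernel into dyadic shells turns this into convergence of \<open>\<phi>\<^sub>M * g\<close>
  (\<open>nn_integral_decaying_kernel_le\<close>, \<open>approximate_identity_at_lebesgue_point\<close>).
\<close>

section \<open>Lebesgue points\<close>

text \<open>The measure of a ball of fixed radius is lower semicontinuous in the centre: a slightly smaller
  concentric ball still satisfies the strict inequality and lies inside all nearby balls. This is what makes
  the exceptional set in the density theorem below a Borel set.\<close>

lemma open_large_ball_measure:
  fixes \<nu> :: "'a::euclidean_space measure" and b :: ennreal
  assumes [measurable_cong]: "sets \<nu> = sets borel"
  shows "open {x. \<exists>r. 0 < r \<and> r < d \<and> b * emeasure lborel (ball x r) < emeasure \<nu> (ball x r)}"
    (is "open ?W")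
proof (rule openI)
  fix x assume "x \<in> ?W"
  then obtain r where r: "0 < r" "r < d" "b * emeasure lborel (ball x r) < emeasure \<nu> (ball x r)"
    by auto
  have "(SUP n. emeasure \<nu> (ball x (r - r / real (Suc n)))) = emeasure \<nu> (\<Union>n. ball x (r - r / real (Suc n)))"
  proof (rule SUP_emeasure_incseq)
    show "incseq (\<lambda>n. ball x (r - r / real (Suc n)))"
      using r(1) by (intro incseq_SucI subset_ball diff_left_mono divide_left_mono) auto
  qed auto
  also have "(\<Union>n. ball x (r - r / real (Suc n))) = ball x r"
  proof (intro subset_antisym subsetI)
    fix y assume "y \<in> ball x r"
    then have "0 < (r - dist x y) / r" using r(1) by simp
    from reals_Archimedean[OF this] obtain n where "inverse (real (Suc n)) < (r - dist x y) / r"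
      by blast
    then have "r / real (Suc n) < r - dist x y"
      using r(1) by (simp add: field_simps)
    then have "y \<in> ball x (r - r / real (Suc n))" by simp
    then show "y \<in> (\<Union>n. ball x (r - r / real (Suc n)))" by (rule UN_I[OF UNIV_I])
  next
    fix y assume "y \<in> (\<Union>n. ball x (r - r / real (Suc n)))"
    then obtain n where "y \<in> ball x (r - r / real (Suc n))" by (elim UN_E)
    moreover have "r - r / real (Suc n) \<le> r" using r(1) by simp
    ultimately show "y \<in> ball x r" by simp
  qed
  finally have "b * emeasure lborel (ball x r) < (SUP n. emeasure \<nu> (ball x (r - r / real (Suc n))))"
    using r(3) by (simp only:)
  then obtain n where n: "b * emeasure lborel (ball x r) < emeasure \<nu> (ball x (r - r / real (Suc n)))"
    unfolding less_SUP_iff by (elim bexE)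
  have "ball x (r / real (Suc n)) \<subseteq> ?W"
  proof
    fix y assume y: "y \<in> ball x (r / real (Suc n))"
    have "ball x (r - r / real (Suc n)) \<subseteq> ball y r"
    proof
      fix z assume "z \<in> ball x (r - r / real (Suc n))"
      with y show "z \<in> ball y r"
        using dist_triangle[of y z x] by (auto simp: dist_commute)
    qed
    then have "emeasure \<nu> (ball x (r - r / real (Suc n))) \<le> emeasure \<nu> (ball y r)"
      by (intro emeasure_mono) auto
    moreover have "emeasure lborel (ball x r) = emeasure lborel (ball y r)"
      using r(1) by (simp add: emeasure_ball)
    ultimately show "y \<in> ?W" using n r by auto
  qed
  then show "\<exists>e>0. ball x e \<subseteq> ?W" using r(1) by (intro exI[of _ "r / real (Suc n)"]) auto
qed

text \<open>One half of the Lebesgue differentiation theorem. Let \<open>E\<close> be the set of points where \<open>h \<le> a\<close> although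
  arbitrarily small balls have \<open>h\<close>-mean above \<open>b\<close>, and let \<open>\<nu>\<close> have density \<open>h\<close>. Clearly \<open>\<nu> E \<le> a |E|\<close>. Inside
  an open \<open>U \<supseteq> E\<close> the Vitali covering theorem selects disjoint balls of mean above \<open>b\<close> that exhaust \<open>E\<close> up to a null
  set, so \<open>b |E| \<le> \<nu> U\<close>, and outer regularity of \<open>\<nu>\<close> gives \<open>b |E| \<le> \<nu> E\<close>. As \<open>a < b\<close>, \<open>E\<close> is null.\<close>

lemma AE_upper_density_le:
  fixes h :: "'a::euclidean_space \<Rightarrow> ennreal" and a b :: ennreal
  assumes [measurable]: "h \<in> borel_measurable borel" and fin: "(\<integral>\<^sup>+x. h x \<partial>lborel) < \<infinity>"
    and ab: "a < b" "b < \<infinity>"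
  shows "AE x in lborel. h x \<le> a \<longrightarrow>
    (\<exists>d>0. \<forall>r. 0 < r \<and> r < d \<longrightarrow> (\<integral>\<^sup>+y. h y * indicator (ball x r) y \<partial>lborel) \<le> b * emeasure lborel (ball x r))"
proof -
  define \<nu> where "\<nu> = density lborel h"
  have \<nu>_sets[simp, measurable_cong]: "sets \<nu> = sets borel" by (simp add: \<nu>_def)
  have \<nu>_eq: "emeasure \<nu> A = (\<integral>\<^sup>+y. h y * indicator A y \<partial>lborel)" if "A \<in> sets borel" for A
    using that by (simp add: \<nu>_def emeasure_density)
  have \<nu>_fin: "emeasure \<nu> (space \<nu>) \<noteq> \<infinity>"
    using fin by (simp add: \<nu>_def emeasure_density)
  then have \<nu>_fin': "emeasure \<nu> A \<noteq> \<infinity>" for A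
    using emeasure_space[of \<nu> A] by (auto simp: top_unique)
  define W where "W d = {x. \<exists>r. 0 < r \<and> r < d \<and> b * emeasure lborel (ball x r) < emeasure \<nu> (ball x r)}" for d :: real
  have W_open: "open (W d)" for d unfolding W_def by (rule open_large_ball_measure) simp
  define E where "E = {x. h x \<le> a} \<inter> (\<Inter>n. W (1 / real (Suc n)))"
  have E[measurable]: "E \<in> sets borel"
    unfolding E_def using W_open by (intro sets.Int sets.countable_INT) (auto intro!: borel_open)
  have W_mono: "W d \<subseteq> W d'" if "d \<le> d'" for d d' using that unfolding W_def by force
  have E_W: "x \<in> W d" if "x \<in> E" "d > 0" for x d
  proof -
    obtain n where "1 / real (Suc n) < d"
      using reals_Archimedean[OF \<open>d > 0\<close>] by (auto simp: inverse_eq_divide)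
    then show ?thesis using W_mono[of "1 / real (Suc n)" d] that by (auto simp: E_def)
  qed
  have up: "emeasure \<nu> E \<le> a * emeasure lborel E"
  proof -
    have "emeasure \<nu> E \<le> (\<integral>\<^sup>+y. a * indicator E y \<partial>lborel)"
      unfolding \<nu>_eq[OF E] by (intro nn_integral_mono) (auto simp: E_def split: split_indicator)
    then show ?thesis by (simp add: nn_integral_cmult_indicator)
  qed
  \<comment> \<open>The Vitali covering argument inside an arbitrary open neighbourhood of E.\<close>
  have low: "b * emeasure lborel E \<le> emeasure \<nu> E"
  proof -
    have "b * emeasure lborel E \<le> emeasure \<nu> U" if U: "E \<subseteq> U" "open U" for U
    proof -
      define K where "K = {(x, r). 0 < r \<and> ball x r \<subseteq> U \<and> b * emeasure lborel (ball x r) < emeasure \<nu> (ball x r)}"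
      have ex: "\<exists>i. i \<in> K \<and> x \<in> ball (fst i) (snd i) \<and> snd i < d" if x: "x \<in> E" "0 < d" for x d
      proof -
        obtain e where e: "e > 0" "ball x e \<subseteq> U" using U x openE by blast
        from E_W[OF x(1), of "min d e"] e x
        obtain r where "0 < r" "r < min d e" "b * emeasure lborel (ball x r) < emeasure \<nu> (ball x r)"
          by (auto simp: W_def)
        moreover have "ball x r \<subseteq> U" using e \<open>r < min d e\<close> by force
        ultimately show ?thesis by (intro exI[of _ "(x, r)"]) (auto simp: K_def)
      qed
      obtain C where C: "countable C" "C \<subseteq> K"
        "pairwise (\<lambda>i j. disjnt (ball (fst i) (snd i)) (ball (fst j) (snd j))) C"
        "negligible (E - (\<Union>i \<in> C. ball (fst i) (snd i)))"
        using Vitali_covering_theorem_balls[of E K fst snd, OF ex] by blast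
      let ?D = "\<Union>i \<in> C. ball (fst i) (snd i)"
      have dj: "disjoint_family_on (\<lambda>i. ball (fst i) (snd i)) C"
        using C(3) by (auto simp: disjoint_family_on_def pairwise_def disjnt_def)
      have D: "?D \<in> sets borel" by (intro borel_open open_UN) auto
      have null: "E - ?D \<in> null_sets lborel"
      proof -
        have "E - ?D \<in> sets lborel" using E D by auto
        moreover have "E - ?D \<in> null_sets lebesgue" using C(4) negligible_iff_null_sets by blast
        ultimately show ?thesis using null_sets_completion_iff by blast
      qed
      have "emeasure lborel E \<le> emeasure lborel (?D \<union> (E - ?D))"
        using E D by (intro emeasure_mono) auto
      also have "\<dots> = emeasure lborel ?D" using null D by (intro emeasure_Un_null_set) auto
      finally have "b * emeasure lborel E \<le> b * emeasure lborel ?D" by (intro mult_left_mono) auto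
      also have "emeasure lborel ?D = (\<integral>\<^sup>+i. emeasure lborel (ball (fst i) (snd i)) \<partial>count_space C)"
        by (rule emeasure_UN_countable) (use C dj in auto)
      also have "b * \<dots> = (\<integral>\<^sup>+i. b * emeasure lborel (ball (fst i) (snd i)) \<partial>count_space C)"
        by (rule nn_integral_cmult[symmetric]) auto
      also have "\<dots> \<le> (\<integral>\<^sup>+i. emeasure \<nu> (ball (fst i) (snd i)) \<partial>count_space C)"
        using C(2) by (intro nn_integral_mono) (auto simp: K_def intro: less_imp_le)
      also have "\<dots> = emeasure \<nu> ?D"
        by (rule emeasure_UN_countable[symmetric]) (use C dj in auto)
      also have "\<dots> \<le> emeasure \<nu> U"
      proof (intro emeasure_mono UN_least)
        fix i assume "i \<in> C"
        then have "i \<in> K" using C(2) by blast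
        then show "ball (fst i) (snd i) \<subseteq> U" by (auto simp: K_def)
      qed (use U in auto)
      finally show ?thesis .
    qed
    then show ?thesis
      using outer_regular[OF \<nu>_sets \<nu>_fin E] by (auto intro!: INF_greatest)
  qed
  have "emeasure lborel E = 0"
  proof (rule ccontr)
    assume ne: "emeasure lborel E \<noteq> 0"
    have "b \<noteq> 0" using ab by auto
    \<comment> \<open>Finiteness is needed for a strict inequality between the two multiples; it follows from b > 0 and the finiteness of the measure.\<close>
    have "emeasure lborel E \<noteq> \<infinity>"
      using low \<nu>_fin'[of E] \<open>b \<noteq> 0\<close> by (auto simp: ennreal_mult_top top_unique)
    then have "a * emeasure lborel E < b * emeasure lborel E"
      using ab ne by (intro ennreal_mult_strict_right_mono) (auto simp: less_top zero_less_iff_neq_zero)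
    then show False using up low by auto
  qed
  then have "AE x in lborel. x \<notin> E" using E by (intro AE_not_in) (auto simp: null_sets_def)
  then show ?thesis
  proof eventually_elim
    case (elim x)
    show ?case
    proof
      assume "h x \<le> a"
      with elim obtain n where n: "x \<notin> W (1 / real (Suc n))" by (auto simp: E_def)
      have "emeasure \<nu> (ball x r) \<le> b * emeasure lborel (ball x r)" if "0 < r" "r < 1 / real (Suc n)" for r
      proof (rule ccontr)
        assume "\<not> ?thesis"
        then have "b * emeasure lborel (ball x r) < emeasure \<nu> (ball x r)" by (rule not_le_imp_less)
        with that have "x \<in> W (1 / real (Suc n))" unfolding W_def by blast
        with n show False by contradiction
      qed
      then show "\<exists>d>0. \<forall>r. 0 < r \<and> r < d \<longrightarrow> (\<integral>\<^sup>+y. h y * indicator (ball x r) y \<partial>lborel) \<le> b * emeasure lborel (ball x r)"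
        unfolding \<nu>_eq[OF borel_open[OF open_ball]]
        by (intro exI[of _ "1 / real (Suc n)"] conjI allI impI) auto
    qed
  qed
qed


text \<open>Almost every point is a Lebesgue point. The density bound is applied to \<open>|g - c|\<close> for \<open>c\<close> in a countable dense set and
  rational thresholds, truncated to large balls to have finite integrals; at a given \<open>x\<close>, a \<open>c\<close> close to \<open>g x\<close> then
  controls the oscillation of \<open>g\<close> around \<open>g x\<close>.\<close>

lemma AE_lebesgue_point:
  fixes g :: "'a::euclidean_space \<Rightarrow> 'b::{real_normed_vector, second_countable_topology}"
  assumes [measurable]: "g \<in> borel_measurable borel"
    and fin: "\<And>R. (\<integral>\<^sup>+x. ennreal (norm (g x)) * indicator (ball 0 R) x \<partial>lborel) < \<infinity>"
  shows "AE x in lborel. \<forall>e>0. \<exists>d>0. \<forall>r. 0 < r \<and> r < d \<longrightarrow>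
    (\<integral>\<^sup>+y. ennreal (norm (g y - g x)) * indicator (ball x r) y \<partial>lborel) \<le> ennreal e * emeasure lborel (ball x r)"
proof -
  obtain D :: "'b set" where D: "countable D" "\<And>X. open X \<Longrightarrow> X \<noteq> {} \<Longrightarrow> \<exists>d\<in>D. d \<in> X"
    using countable_dense_setE by blast
  define h where "h m c y = ennreal (norm (g y - c)) * indicator (ball 0 (real m + 1)) y" for m c y
  have h_meas[measurable]: "h m c \<in> borel_measurable borel" for m c
    unfolding h_def by (intro borel_measurable_times_ennreal borel_measurable_indicator) auto
  have h_fin: "(\<integral>\<^sup>+x. h m c x \<partial>lborel) < \<infinity>" for m c
  proof -
    let ?B = "ball 0 (real m + 1) :: 'a set"
    have "(\<integral>\<^sup>+x. h m c x \<partial>lborel) \<le>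
        (\<integral>\<^sup>+x. ennreal (norm (g x)) * indicator ?B x + ennreal (norm c) * indicator ?B x \<partial>lborel)"
      unfolding h_def
      by (intro nn_integral_mono)
         (auto split: split_indicator simp flip: ennreal_plus intro!: ennreal_leI norm_triangle_ineq4)
    also have "\<dots> = (\<integral>\<^sup>+x. ennreal (norm (g x)) * indicator ?B x \<partial>lborel) + ennreal (norm c) * emeasure lborel ?B"
      by (subst nn_integral_add) (auto simp: nn_integral_cmult_indicator intro!: borel_measurable_times_ennreal borel_measurable_indicator)
    also have "\<dots> < \<infinity>"
      using fin[of "real m + 1"] by (simp add: ennreal_mult_less_top emeasure_ball)
    finally show ?thesis .
  qed
  have "AE x in lborel. \<forall>m. \<forall>c\<in>D. \<forall>q\<in>{0<..} \<inter> \<rat>. h m c x \<le> ennreal q \<longrightarrow>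
     (\<exists>d>0. \<forall>r. 0 < r \<and> r < d \<longrightarrow>
        (\<integral>\<^sup>+y. h m c y * indicator (ball x r) y \<partial>lborel) \<le> ennreal (2 * q) * emeasure lborel (ball x r))"
    unfolding AE_all_countable
    by (intro allI AE_ball_countable' D(1) countable_Int2 countable_rat AE_upper_density_le h_meas h_fin)
       (auto simp: ennreal_less_iff)
  then show ?thesis
  proof eventually_elim
    case (elim x)
    show ?case
    proof (intro allI impI)
      fix e :: real assume "e > 0"
      then obtain q where q: "q \<in> \<rat>" "0 < q" "q < e / 3"
        using Rats_dense_in_real[of 0 "e / 3"] by auto
      obtain c where c: "c \<in> D" "c \<in> ball (g x) q"
        using D(2)[of "ball (g x) q"] q by auto
      obtain m :: nat where m: "norm x < real m" using reals_Archimedean2 by blast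
      have "h m c x \<le> ennreal q"
        using c(2) by (auto simp: h_def dist_norm split: split_indicator intro!: ennreal_leI)
      then obtain d where d: "d > 0" "\<And>r. 0 < r \<Longrightarrow> r < d \<Longrightarrow>
        (\<integral>\<^sup>+y. h m c y * indicator (ball x r) y \<partial>lborel) \<le> ennreal (2 * q) * emeasure lborel (ball x r)"
        using elim c(1) q by blast
      show "\<exists>d>0. \<forall>r. 0 < r \<and> r < d \<longrightarrow>
        (\<integral>\<^sup>+y. ennreal (norm (g y - g x)) * indicator (ball x r) y \<partial>lborel) \<le> ennreal e * emeasure lborel (ball x r)"
      proof (intro exI[of _ "min d 1"] conjI allI impI)
        fix r assume r: "0 < r \<and> r < min d 1"
        have "(\<integral>\<^sup>+y. ennreal (norm (g y - g x)) * indicator (ball x r) y \<partial>lborel) \<le>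
           (\<integral>\<^sup>+y. h m c y * indicator (ball x r) y + ennreal q * indicator (ball x r) y \<partial>lborel)"
        proof (intro nn_integral_mono)
          fix y
          have "norm (g y - g x) \<le> norm (g y - c) + q"
            using c(2) norm_triangle_ineq[of "g y - c" "c - g x"] by (simp add: dist_norm norm_minus_commute)
          moreover have "norm y < real m + 1" if "dist x y < r"
            using that r m norm_triangle_ineq[of "y - x" x] by (simp add: dist_norm norm_minus_commute)
          ultimately show "ennreal (norm (g y - g x)) * indicator (ball x r) y \<le>
              h m c y * indicator (ball x r) y + ennreal q * indicator (ball x r) y"
            using q by (auto simp: h_def split: split_indicator simp flip: ennreal_plus intro!: ennreal_leI)
        qed
        also have "\<dots> = (\<integral>\<^sup>+y. h m c y * indicator (ball x r) y \<partial>lborel) + ennreal q * emeasure lborel (ball x r)"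
          by (subst nn_integral_add)
             (auto simp: nn_integral_cmult_indicator intro!: borel_measurable_times_ennreal borel_measurable_indicator)
        also have "\<dots> \<le> ennreal (2 * q) * emeasure lborel (ball x r) + ennreal q * emeasure lborel (ball x r)"
          using d(2)[of r] r by (intro add_right_mono) auto
        also have "\<dots> = ennreal (3 * q) * emeasure lborel (ball x r)"
          using q by (simp flip: distrib_right ennreal_plus)
        also have "\<dots> \<le> ennreal e * emeasure lborel (ball x r)"
          using q by (intro mult_right_mono ennreal_leI) auto
        finally show "(\<integral>\<^sup>+y. ennreal (norm (g y - g x)) * indicator (ball x r) y \<partial>lborel) \<le> ennreal e * emeasure lborel (ball x r)" .
      qed (use d in auto)
    qed
  qed
qed

section \<open>Calculus of \<open>C\<^sup>k\<close> functions\<close>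

lemma Ck_on_cong:
  assumes "open S" and "\<And>x. x \<in> S \<Longrightarrow> f x = g x" and "Ck_on k S f"
  shows "Ck_on k S g"
  using assms(2,3)
proof (induction k arbitrary: f g)
  case 0
  then show ?case by (metis Ck_on.simps(1) continuous_on_cong)
next
  case (Suc k)
  have *: "g differentiable (at x) \<and> frechet_derivative g (at x) = frechet_derivative f (at x)"
    if "x \<in> S" for x
  proof -
    have "(f has_derivative frechet_derivative f (at x)) (at x)"
      using Suc.prems that frechet_derivative_works by auto
    then have "(g has_derivative frechet_derivative f (at x)) (at x)"
      by (rule has_derivative_transform_within_open[OF _ assms(1) that]) (use Suc.prems in auto)
    then show ?thesis
      using differentiableI frechet_derivative_at by metis
  qed
  show ?case
    unfolding Ck_on.simps
  proof (intro conjI ballI allI)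
    fix v
    have "Ck_on k S (\<lambda>x. frechet_derivative f (at x) v)" using Suc.prems by simp
    then show "Ck_on k S (\<lambda>x. frechet_derivative g (at x) v)"
      by (rule Suc.IH[rotated]) (simp add: *)
  qed (use * in auto)
qed

text \<open>Allows derivatives to be computed by any rule for \<open>has_derivative\<close>, so that the predicate can be established
  without computing \<open>frechet_derivative\<close> itself.\<close>

lemma Ck_on_SucI:
  assumes "open S" and "\<And>x. x \<in> S \<Longrightarrow> (f has_derivative D x) (at x)"
    and "\<And>v. Ck_on k S (\<lambda>x. D x v)"
  shows "Ck_on (Suc k) S f"
  unfolding Ck_on.simps
proof (intro conjI ballI allI)
  fix v
  show "Ck_on k S (\<lambda>x. frechet_derivative f (at x) v)"
    by (rule Ck_on_cong[OF assms(1) _ assms(3)[of v]]) (metis assms(2) frechet_derivative_at)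
qed (use assms(2) differentiableI in blast)

lemma Ck_on_SucD:
  assumes "Ck_on (Suc k) S f"
  shows "x \<in> S \<Longrightarrow> (f has_derivative frechet_derivative f (at x)) (at x)"
    and "Ck_on k S (\<lambda>x. frechet_derivative f (at x) v)"
  using assms frechet_derivative_works by auto

lemma Ck_on_Suc_imp: "Ck_on (Suc k) S f \<Longrightarrow> Ck_on k S f"
proof (induction k arbitrary: f)
  case 0
  then show ?case
    by (auto intro!: continuous_at_imp_continuous_on differentiable_imp_continuous_within)
next
  case (Suc k)
  then show ?case by (metis Ck_on.simps(2))
qed

lemma Ck_on_imp_continuous_on: "Ck_on k S f \<Longrightarrow> continuous_on S f"
  by (induction k) (use Ck_on_Suc_imp in auto)

lemma Ck_on_subset: "Ck_on k S f \<Longrightarrow> T \<subseteq> S \<Longrightarrow> Ck_on k T f"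
  by (induction k arbitrary: f) (auto intro: continuous_on_subset)

text \<open>Used to glue a function that is given by different formulas near the origin and away from it, and to
  differentiate locally finite sums.\<close>

lemma Ck_on_locally:
  assumes "\<And>x. x \<in> S \<Longrightarrow> \<exists>T. open T \<and> x \<in> T \<and> Ck_on k T f"
  shows "Ck_on k S f"
  using assms
proof (induction k arbitrary: f)
  case 0
  then have "isCont f x" if "x \<in> S" for x
    using that by (metis Ck_on.simps(1) continuous_on_eq_continuous_at)
  then show ?case by (simp add: continuous_at_imp_continuous_on)
next
  case (Suc k)
  show ?case
    unfolding Ck_on.simps
  proof (intro conjI ballI allI)
    show "Ck_on k S (\<lambda>x. frechet_derivative f (at x) v)" for v
      using Suc.prems by (intro Suc.IH) (metis Ck_on.simps(2))
  qed (use Suc.prems in \<open>metis Ck_on.simps(2)\<close>)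
qed

lemma Ck_on_const: "open S \<Longrightarrow> Ck_on k S (\<lambda>x. c)"
proof (induction k arbitrary: c)
  case (Suc k)
  show ?case by (rule Ck_on_SucI[where D="\<lambda>x v. 0"]) (use Suc in auto)
qed auto

lemma Ck_on_bounded_linear: "open S \<Longrightarrow> bounded_linear T \<Longrightarrow> Ck_on k S T"
proof (cases k)
  case 0
  then show "bounded_linear T \<Longrightarrow> ?thesis" by (simp add: linear_continuous_on)
next
  case (Suc m)
  assume "open S" "bounded_linear T"
  then show ?thesis unfolding Suc
    by (intro Ck_on_SucI[where D="\<lambda>x v. T v"])
       (auto intro: bounded_linear_imp_has_derivative Ck_on_const)
qed

lemma Ck_on_add: "open S \<Longrightarrow> Ck_on k S f \<Longrightarrow> Ck_on k S g \<Longrightarrow> Ck_on k S (\<lambda>x. f x + g x)"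
proof (induction k arbitrary: f g)
  case (Suc k)
  show ?case
    by (rule Ck_on_SucI[OF Suc.prems(1) has_derivative_add])
       (use Suc Ck_on_SucD in blast)+
qed (auto intro!: continuous_intros)

lemma Ck_on_sum:
  "open S \<Longrightarrow> (\<And>i. i \<in> I \<Longrightarrow> Ck_on k S (f i)) \<Longrightarrow> Ck_on k S (\<lambda>x. \<Sum>i\<in>I. f i x)"
  by (induction I rule: infinite_finite_induct) (auto intro: Ck_on_add Ck_on_const)

lemma Ck_on_mult:
  fixes f g :: "'a::euclidean_space \<Rightarrow> 'b::real_normed_algebra"
  shows "open S \<Longrightarrow> Ck_on k S f \<Longrightarrow> Ck_on k S g \<Longrightarrow> Ck_on k S (\<lambda>x. f x * g x)"
proof (induction k arbitrary: f g)
  case (Suc k)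
  show ?case
  proof (rule Ck_on_SucI[OF Suc.prems(1)])
    fix x assume "x \<in> S"
    then show "((\<lambda>x. f x * g x) has_derivative
        (\<lambda>v. f x * frechet_derivative g (at x) v + frechet_derivative f (at x) v * g x)) (at x)"
      using Suc.prems by (intro has_derivative_mult Ck_on_SucD(1)) auto
  next
    fix v
    show "Ck_on k S (\<lambda>x. f x * frechet_derivative g (at x) v + frechet_derivative f (at x) v * g x)"
      using Suc.prems(1) Ck_on_Suc_imp[OF Suc.prems(2)] Ck_on_Suc_imp[OF Suc.prems(3)]
        Ck_on_SucD(2)[OF Suc.prems(2)] Ck_on_SucD(2)[OF Suc.prems(3)]
      by (intro Ck_on_add Suc.IH)
  qed
qed (auto intro!: continuous_intros)

lemma Ck_on_inverse:
  fixes f :: "'a::euclidean_space \<Rightarrow> 'b::real_normed_field"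
  shows "open S \<Longrightarrow> Ck_on k S f \<Longrightarrow> (\<And>x. x \<in> S \<Longrightarrow> f x \<noteq> 0) \<Longrightarrow> Ck_on k S (\<lambda>x. inverse (f x))"
proof (induction k arbitrary: f)
  case (Suc k)
  show ?case
  proof (rule Ck_on_SucI[OF Suc.prems(1)])
    fix x assume "x \<in> S"
    then show "((\<lambda>x. inverse (f x)) has_derivative
        (\<lambda>v. (-1) * (inverse (f x) * frechet_derivative f (at x) v * inverse (f x)))) (at x)"
      using Deriv.has_derivative_inverse[OF Suc.prems(3)[OF \<open>x \<in> S\<close>]
          Ck_on_SucD(1)[OF Suc.prems(2) \<open>x \<in> S\<close>]]
      by simp
  next
    fix v
    show "Ck_on k S (\<lambda>x. (-1) * (inverse (f x) * frechet_derivative f (at x) v * inverse (f x)))"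
      using Suc.prems(1,3) Ck_on_Suc_imp[OF Suc.prems(2)] Ck_on_SucD(2)[OF Suc.prems(2)]
      by (intro Ck_on_mult Ck_on_const Suc.IH)
  qed
qed (simp add: continuous_on_inverse)

lemma Ck_on_bounded_linear_compose:
  "open S \<Longrightarrow> bounded_linear T \<Longrightarrow> Ck_on k S f \<Longrightarrow> Ck_on k S (\<lambda>x. T (f x))"
proof (induction k arbitrary: f)
  case 0
  then show ?case by (simp add: bounded_linear.continuous_on)
next
  case (Suc k)
  show ?case
    by (rule Ck_on_SucI[OF Suc.prems(1) bounded_linear.has_derivative[OF Suc.prems(2)]])
       (use Suc Ck_on_SucD in blast)+
qed

lemma Ck_on_scale:
  "open T \<Longrightarrow> Ck_on k S f \<Longrightarrow> (\<And>x. x \<in> T \<Longrightarrow> c *\<^sub>R x \<in> S) \<Longrightarrow> Ck_on k T (\<lambda>x. f (c *\<^sub>R x))"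
proof (induction k arbitrary: f)
  case 0
  then show ?case by (auto intro!: continuous_on_compose2[of S f] continuous_intros)
next
  case (Suc k)
  show ?case
  proof (rule Ck_on_SucI[OF Suc.prems(1)])
    fix x assume "x \<in> T"
    show "((\<lambda>x. f (c *\<^sub>R x)) has_derivative (\<lambda>v. frechet_derivative f (at (c *\<^sub>R x)) (c *\<^sub>R v))) (at x)"
      by (rule has_derivative_compose[OF _ Ck_on_SucD(1)[OF Suc.prems(2)]])
         (auto intro!: Suc.prems(3) \<open>x \<in> T\<close> bounded_linear_imp_has_derivative bounded_linear_scaleR_right)
  next
    fix v
    show "Ck_on k T (\<lambda>x. frechet_derivative f (at (c *\<^sub>R x)) (c *\<^sub>R v))"
      by (rule Suc.IH[OF Suc.prems(1) Ck_on_SucD(2)[OF Suc.prems(2)] Suc.prems(3)])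
  qed
qed

text \<open>The truncated powers replace the usual smooth bump functions: they have exactly as many continuous derivatives as
  required and an explicit recursion for them.\<close>

lemma has_derivative_max0_power:
  "((\<lambda>t::real. max 0 t ^ (m+2)) has_real_derivative (real (m+2) * max 0 t ^ (m+1))) (at t)"
proof (cases "t = 0")
  case True
  have "((\<lambda>h::real. (max 0 (0+h) ^ (m+2) - max 0 0 ^ (m+2)) / h) \<longlongrightarrow> 0) (at 0)"
  proof (rule Lim_null_comparison)
    have "\<bar>max 0 h ^ Suc (Suc m) / h\<bar> \<le> \<bar>h\<bar> ^ (m+1)" for h :: real
    proof (cases "h > 0")
      case True
      then show ?thesis by (simp add: max_def)
    qed (simp add: max_absorb1 mult_nonpos_nonneg)
    then show "\<forall>\<^sub>F h in at 0. norm ((max 0 (0+h) ^ (m+2) - max 0 0 ^ (m+2)) / h) \<le> \<bar>h\<bar> ^ (m+1)"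
      by simp
    show "((\<lambda>h::real. \<bar>h\<bar> ^ (m+1)) \<longlongrightarrow> 0) (at 0)"
      by (rule tendsto_eq_intros refl | simp)+
  qed
  then show ?thesis
    using True by (simp add: has_field_derivative_iff)
next
  case False
  show ?thesis
  proof (cases "t > 0")
    case True
    have "((\<lambda>t::real. t ^ (m+2)) has_real_derivative (real (m+2) * max 0 t ^ (m+1))) (at t)"
      using DERIV_pow[of "m+2" t UNIV] True by (simp add: max_def)
    then show ?thesis
      by (rule has_field_derivative_transform_within_open[where S="{0<..}"]) (use True in \<open>auto simp: max_def\<close>)
  next
    case f: False
    have "((\<lambda>t::real. 0) has_real_derivative (real (m+2) * max 0 t ^ (m+1))) (at t)"
      using f by (auto intro!: derivative_eq_intros simp: max_absorb1)
    then show ?thesis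
      by (rule has_field_derivative_transform_within_open[where S="{..<0}"])
         (use f False in \<open>auto simp: max_absorb1\<close>)
  qed
qed

lemma Ck_on_max0_power:
  fixes q :: "'a::euclidean_space \<Rightarrow> real"
  assumes "open S" and "\<And>k. Ck_on k S q"
  shows "Ck_on k S (\<lambda>x. max 0 (q x) ^ (k+1))"
proof (induction k)
  case 0
  have "continuous_on S q" using assms(2)[of 0] by simp
  then show ?case by (simp add: continuous_on_max)
next
  case (Suc k)
  show ?case
  proof (rule Ck_on_SucI[OF assms(1)])
    fix x assume "x \<in> S"
    show "((\<lambda>x. max 0 (q x) ^ (Suc k + 1)) has_derivative
      (\<lambda>v. frechet_derivative q (at x) v * (real (k+2) * max 0 (q x) ^ (k+1)))) (at x)"
      using has_derivative_compose[OF Ck_on_SucD(1)[OF assms(2) \<open>x \<in> S\<close>]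
          has_derivative_max0_power[of k "q x", unfolded has_field_derivative_def]]
      by (simp add: mult.commute)
  next
    fix v
    show "Ck_on k S (\<lambda>x. frechet_derivative q (at x) v * (real (k+2) * max 0 (q x) ^ (k+1)))"
      by (intro Ck_on_mult Ck_on_const Suc.IH Ck_on_SucD(2) assms)
  qed
qed

section \<open>The Fourier transform on integrable functions\<close>

lemma lebesgue_affine_scaleR:
  fixes t :: "'a::euclidean_space"
  assumes "c \<noteq> 0"
  shows "lebesgue = density (distr lebesgue lebesgue (\<lambda>x. t + c *\<^sub>R x)) (\<lambda>_. ennreal (\<bar>c\<bar> ^ DIM('a)))"
    and "(\<lambda>x. t + c *\<^sub>R x) \<in> lebesgue \<rightarrow>\<^sub>M lebesgue"
  using lebesgue_affine_euclidean[where c="\<lambda>_::'a. c" and t=t] lebesgue_affine_measurable[where c="\<lambda>_::'a. c" and t=t] assms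
  unfolding scaleR_scaleR[symmetric] scaleR_sum_right[symmetric] euclidean_representation prod_constant
  by simp_all

lemma integrable_lebesgue_affine:
  fixes f :: "'a::euclidean_space \<Rightarrow> 'b::{banach, second_countable_topology}"
  assumes c: "c \<noteq> 0" and f: "integrable lebesgue f"
  shows "integrable lebesgue (\<lambda>x. f (t + c *\<^sub>R x))"
proof -
  note [measurable] = lebesgue_affine_scaleR(2)[OF c, of t] borel_measurable_integrable[OF f]
  have "integrable (density (distr lebesgue lebesgue (\<lambda>x. t + c *\<^sub>R x)) (\<lambda>_. ennreal (\<bar>c\<bar> ^ DIM('a)))) f"
    using f lebesgue_affine_scaleR(1)[OF c, of t] by simp
  then have "integrable (distr lebesgue lebesgue (\<lambda>x. t + c *\<^sub>R x)) (\<lambda>x. \<bar>c\<bar> ^ DIM('a) *\<^sub>R f x)"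
    by (subst (asm) integrable_density) auto
  then have "integrable lebesgue (\<lambda>x. \<bar>c\<bar> ^ DIM('a) *\<^sub>R f (t + c *\<^sub>R x))"
    by (subst (asm) integrable_distr_eq) auto
  then have "integrable lebesgue (\<lambda>x. inverse (\<bar>c\<bar> ^ DIM('a)) *\<^sub>R \<bar>c\<bar> ^ DIM('a) *\<^sub>R f (t + c *\<^sub>R x))"
    by (rule integrable_scaleR_right)
  also have "(\<lambda>x. inverse (\<bar>c\<bar> ^ DIM('a)) *\<^sub>R \<bar>c\<bar> ^ DIM('a) *\<^sub>R f (t + c *\<^sub>R x)) = (\<lambda>x. f (t + c *\<^sub>R x))"
    using c by (simp add: fun_eq_iff)
  finally show ?thesis .
qed

lemma integrable_lebesgue_affine_iff:
  fixes f :: "'a::euclidean_space \<Rightarrow> 'b::{banach, second_countable_topology}"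
  assumes c: "c \<noteq> 0"
  shows "integrable lebesgue (\<lambda>x. f (t + c *\<^sub>R x)) \<longleftrightarrow> integrable lebesgue f"
proof
  assume "integrable lebesgue (\<lambda>x. f (t + c *\<^sub>R x))"
  from integrable_lebesgue_affine[OF _ this, of "1/c" "- (1/c) *\<^sub>R t"] c
  show "integrable lebesgue f" by (simp add: scaleR_right_diff_distrib)
qed (rule integrable_lebesgue_affine[OF c])

text \<open>Holds for every \<open>f\<close>, because both integrals take the default value \<open>0\<close> as soon as one of
  the integrands fails to be integrable.\<close>

lemma integral_lebesgue_affine:
  fixes f :: "'a::euclidean_space \<Rightarrow> 'b::{banach, second_countable_topology}"
  assumes c: "c \<noteq> 0"
  shows "(LINT x|lebesgue. f x) = \<bar>c\<bar> ^ DIM('a) *\<^sub>R (LINT x|lebesgue. f (t + c *\<^sub>R x))"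
proof (cases "integrable lebesgue f")
  case True
  note [measurable] = lebesgue_affine_scaleR(2)[OF c, of t] borel_measurable_integrable[OF True]
  have "(LINT x|lebesgue. f x) =
      integral\<^sup>L (density (distr lebesgue lebesgue (\<lambda>x. t + c *\<^sub>R x)) (\<lambda>_. ennreal (\<bar>c\<bar> ^ DIM('a)))) f"
    using lebesgue_affine_scaleR(1)[OF c, of t] by simp
  also have "\<dots> = integral\<^sup>L (distr lebesgue lebesgue (\<lambda>x. t + c *\<^sub>R x)) (\<lambda>x. \<bar>c\<bar> ^ DIM('a) *\<^sub>R f x)"
    by (subst integral_density) auto
  also have "\<dots> = (LINT x|lebesgue. \<bar>c\<bar> ^ DIM('a) *\<^sub>R f (t + c *\<^sub>R x))"
    by (subst integral_distr) auto
  finally show ?thesis by simp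
next
  case False
  then show ?thesis using integrable_lebesgue_affine_iff[OF c, of f t]
    by (simp add: not_integrable_integral_eq)
qed

lemma integrable_lebesgueI:
  fixes f :: "'a::euclidean_space \<Rightarrow> 'b::{banach, second_countable_topology}"
  shows "integrable lborel f \<Longrightarrow> integrable lebesgue f"
  using integrable_completion[of f lborel] borel_measurable_integrable by blast

lemma borel_measurable_lebesgue_continuous:
  fixes f :: "'a::euclidean_space \<Rightarrow> 'b::real_normed_vector"
  assumes "continuous_on UNIV f"
  shows "f \<in> borel_measurable lebesgue"
  by (rule measurable_completion) (simp add: borel_measurable_continuous_onI[OF assms])

lemma integrable_continuous_compact_support:
  fixes f :: "'a::euclidean_space \<Rightarrow> 'b::{banach, second_countable_topology}"
  assumes "continuous_on UNIV f" and "\<And>x. R < norm x \<Longrightarrow> f x = 0"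
  shows "integrable lborel f"
proof -
  have "integrable lborel (\<lambda>x. indicator (cball 0 R) x *\<^sub>R f x)"
    by (rule borel_integrable_compact) (auto intro: continuous_on_subset[OF assms(1)])
  also have "(\<lambda>x. indicator (cball 0 R) x *\<^sub>R f x) = f"
    using assms(2) by (auto simp: fun_eq_iff indicator_def not_le)
  finally show ?thesis .
qed

lemma bounded_continuous_compact_support:
  fixes f :: "'a::euclidean_space \<Rightarrow> 'b::real_normed_vector"
  assumes "continuous_on UNIV f" and "\<And>x. R < norm x \<Longrightarrow> f x = 0"
  obtains B where "B \<ge> 0" "\<And>x. norm (f x) \<le> B"
proof -
  have "compact (f ` cball 0 R)"
    by (intro compact_continuous_image continuous_on_subset[OF assms(1)]) auto
  then obtain B where B: "\<And>x. x \<in> cball 0 R \<Longrightarrow> norm (f x) \<le> B"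
    using compact_imp_bounded bounded_iff by (metis imageI)
  show ?thesis
  proof (rule that[of "max B 0"])
    fix x show "norm (f x) \<le> max B 0"
      using B[of x] assms(2)[of x] by (cases "norm x \<le> R") auto
  qed auto
qed

lemma norm_fourier_kernel [simp]:
  "norm (exp (- (2 * complex_of_real pi * \<i> * complex_of_real t))) = 1"
  by (simp add: norm_exp_eq_Re)

lemma continuous_on_fourier_kernel:
  "continuous_on UNIV (\<lambda>x::real^'n. exp (- (2 * complex_of_real pi * \<i> * complex_of_real (x \<bullet> \<xi>))))"
  by (intro continuous_intros)

lemma measurable_fourier_kernel:
  "(\<lambda>x::real^'n. exp (- (2 * complex_of_real pi * \<i> * complex_of_real (x \<bullet> \<xi>)))) \<in> borel_measurable borel"
  by (intro borel_measurable_continuous_onI continuous_on_fourier_kernel)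

lemma integrable_mult_fourier_kernel:
  fixes f :: "real^'n \<Rightarrow> complex"
  assumes "integrable lebesgue f"
  shows "integrable lebesgue (\<lambda>x. f x * exp (- (2 * complex_of_real pi * \<i> * complex_of_real (x \<bullet> \<xi>))))"
proof (rule Bochner_Integration.integrable_bound[OF assms])
  show "(\<lambda>x. f x * exp (- (2 * complex_of_real pi * \<i> * complex_of_real (x \<bullet> \<xi>)))) \<in> borel_measurable lebesgue"
    by (intro borel_measurable_times borel_measurable_integrable[OF assms] measurable_completion)
       (use measurable_fourier_kernel[of \<xi>] in simp)
qed (simp add: norm_mult)

lemma fourier_diff:
  assumes "integrable lebesgue f" "integrable lebesgue g"
  shows "fourier (\<lambda>x. f x - g x) \<xi> = fourier f \<xi> - fourier g \<xi>"
  unfolding fourier_def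
  by (simp add: left_diff_distrib integrable_mult_fourier_kernel assms)

lemma norm_fourier_le:
  assumes "integrable lebesgue f"
  shows "norm (fourier f \<xi>) \<le> (LINT x|lebesgue. norm (f x))"
  unfolding fourier_def
  by (rule order_trans[OF integral_norm_bound]) (simp add: norm_mult)

lemma fourier_dilate:
  fixes h :: "real^'n \<Rightarrow> complex"
  shows   "fourier (dilate j h) \<xi> = fourier h ((2 powi (-j) :: real) *\<^sub>R \<xi>)"
proof -
  have inner: "((2 powi j :: real) *\<^sub>R x) \<bullet> ((2 powi (-j) :: real) *\<^sub>R \<xi>) = x \<bullet> \<xi>" for x
    by (simp add: power_int_minus)
  have "fourier h ((2 powi (-j) :: real) *\<^sub>R \<xi>) =
    \<bar>2 powi j :: real\<bar> ^ DIM(real^'n) *\<^sub>R (LINT x|lebesgue. h ((2 powi j :: real) *\<^sub>R x) *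
       exp (- (2 * complex_of_real pi * \<i> * complex_of_real (((2 powi j :: real) *\<^sub>R x) \<bullet> ((2 powi (-j) :: real) *\<^sub>R \<xi>)))))"
    unfolding fourier_def by (subst integral_lebesgue_affine[of "2 powi j" _ 0]) auto
  also have "\<dots> = fourier (dilate j h) \<xi>"
    unfolding fourier_def dilate_def inner
    by (simp add: power_int_mult power_int_of_nat flip: integral_scaleR_right)
  finally show ?thesis by simp
qed

lemma integrable_dilate: "integrable lebesgue h \<Longrightarrow> integrable lebesgue (dilate j h)"
  using integrable_lebesgue_affine[of "2 powi j" h 0] unfolding dilate_def by simp

lemma fourier_translate:
  fixes f :: "real^'n \<Rightarrow> complex"
  shows "fourier (\<lambda>x. f (v + x)) \<xi> = exp (2 * complex_of_real pi * \<i> * complex_of_real (v \<bullet> \<xi>)) * fourier f \<xi>"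
proof -
  have "fourier f \<xi> = (LINT x|lebesgue. f (v + x) * exp (- (2 * complex_of_real pi * \<i> * complex_of_real ((v + x) \<bullet> \<xi>))))"
    unfolding fourier_def by (subst integral_lebesgue_affine[of 1 _ v]) auto
  also have "\<dots> = (LINT x|lebesgue. exp (- (2 * complex_of_real pi * \<i> * complex_of_real (v \<bullet> \<xi>))) * (f (v + x) * exp (- (2 * complex_of_real pi * \<i> * complex_of_real (x \<bullet> \<xi>)))))"
    by (simp add: inner_add_left distrib_left exp_add exp_minus exp_diff field_simps)
  also have "\<dots> = exp (- (2 * complex_of_real pi * \<i> * complex_of_real (v \<bullet> \<xi>))) * fourier (\<lambda>x. f (v + x)) \<xi>"
    unfolding fourier_def by (rule integral_mult_right_zero)
  finally show ?thesis by (simp add: exp_minus)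
qed

lemma continuous_fourier:
  fixes f :: "real^'n \<Rightarrow> complex"
  assumes "integrable lebesgue f"
  shows "continuous_on UNIV (fourier f)"
  unfolding continuous_on_eq_continuous_at[OF open_UNIV]
proof
  fix x :: "real^'n"
  show "isCont (fourier f) x"
    unfolding isCont_def tendsto_at_iff_sequentially comp_def
  proof (intro allI impI)
    fix X assume X: "X \<longlonglongrightarrow> x"
    show "(\<lambda>n. fourier f (X n)) \<longlonglongrightarrow> fourier f x"
      unfolding fourier_def
    proof (rule integral_dominated_convergence[where w="\<lambda>y. norm (f y)"])
      show "AE y in lebesgue. (\<lambda>n. f y * exp (- (2 * complex_of_real pi * \<i> * complex_of_real (y \<bullet> X n))))
         \<longlonglongrightarrow> f y * exp (- (2 * complex_of_real pi * \<i> * complex_of_real (y \<bullet> x)))"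
        by (intro AE_I2 tendsto_intros X)
    qed (use assms integrable_mult_fourier_kernel[OF assms] in \<open>auto simp: norm_mult\<close>)
  qed
qed

section \<open>Smoothness gives decay of the Fourier transform\<close>

lemma C1_compact_support_derivative:
  fixes f :: "'a::euclidean_space \<Rightarrow> 'b::real_normed_vector"
  assumes "\<And>x. R < norm x \<Longrightarrow> f x = 0" and "R < norm x"
  shows "frechet_derivative f (at x) v = 0"
proof -
  have "((\<lambda>x. 0) has_derivative (\<lambda>v. 0)) (at x)" by simp
  then have "(f has_derivative (\<lambda>v. 0)) (at x)"
    by (rule has_derivative_transform_within_open[OF _ open_Compl[OF closed_cball[of 0 R]]]) (use assms in auto)
  then show ?thesis using frechet_derivative_at by metis
qed

lemma norm_difference_le_directional:
  fixes f :: "'a::euclidean_space \<Rightarrow> 'b::real_normed_vector"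
  assumes f: "\<And>x. f differentiable (at x)" and B: "\<And>x. norm (frechet_derivative f (at x) v) \<le> B"
    and t: "t \<ge> 0"
  shows "norm (f (x + t *\<^sub>R v) - f x) \<le> B * t"
proof -
  have der: "((\<lambda>s. f (x + s *\<^sub>R v)) has_derivative (\<lambda>h. h *\<^sub>R frechet_derivative f (at (x + s *\<^sub>R v)) v)) (at s within {0..t})"
    for s
  proof -
    have "((\<lambda>s. f (x + s *\<^sub>R v)) has_derivative (\<lambda>h. frechet_derivative f (at (x + s *\<^sub>R v)) (h *\<^sub>R v))) (at s within {0..t})"
      using f frechet_derivative_works
      by (intro has_derivative_compose[of "\<lambda>s. x + s *\<^sub>R v" "\<lambda>h. h *\<^sub>R v" _ _ f]) (auto intro!: derivative_eq_intros)
    moreover have "frechet_derivative f (at (x + s *\<^sub>R v)) (h *\<^sub>R v) = h *\<^sub>R frechet_derivative f (at (x + s *\<^sub>R v)) v" for h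
      using f by (intro linear_scale linear_frechet_derivative)
    ultimately show ?thesis by simp
  qed
  have "norm (f (x + t *\<^sub>R v) - f (x + 0 *\<^sub>R v)) \<le> B * norm (t - 0)"
  proof (rule differentiable_bound[OF convex_closed_interval(1)[of 0 t] der])
    have "0 \<le> B" using B[of 0] norm_ge_zero order_trans by blast
    then show "onorm (\<lambda>h. h *\<^sub>R frechet_derivative f (at (x + s *\<^sub>R v)) v) \<le> B" for s
      using B by (intro onorm_bound) (auto simp: mult.commute[of B] mult_left_mono)
  qed (use t in auto)
  then show ?thesis using t by simp
qed

text \<open>Integration by parts in disguise. By translation invariance, the Fourier transform of a difference quotient of \<open>f\<close> is
  the Fourier transform of \<open>f\<close> times a difference quotient of an exponential. Letting the step tend to \<open>0\<close> on both
  sides gives the claim; a bound for the directional derivative dominates the difference quotients.\<close>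

lemma fourier_frechet_derivative:
  fixes f :: "real^'n \<Rightarrow> complex"
  assumes f: "Ck_on (Suc 0) UNIV f" and R: "\<And>x. R < norm x \<Longrightarrow> f x = 0"
  shows "fourier (\<lambda>x. frechet_derivative f (at x) v) \<xi> =
    2 * complex_of_real pi * \<i> * complex_of_real (v \<bullet> \<xi>) * fourier f \<xi>"
proof -
  let ?D = "\<lambda>x. frechet_derivative f (at x) v"
  let ?e = "\<lambda>x. exp (- (2 * complex_of_real pi * \<i> * complex_of_real (x \<bullet> \<xi>)))"
  define t where "t n = inverse (real (Suc n))" for n
  have t: "t \<longlonglongrightarrow> 0" "t n > 0" "t n \<le> 1" for n
    using LIMSEQ_inverse_real_of_nat by (auto simp: t_def[abs_def] divide_simps)
  have f_cont: "continuous_on UNIV f" using Ck_on_imp_continuous_on[OF f] .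
  have f_diff: "f differentiable (at x)" for x using f by simp
  have D_cont: "continuous_on UNIV ?D" using f by simp
  have D0: "?D x = 0" if "R < norm x" for x
    using C1_compact_support_derivative[of R f, OF R that] .
  obtain B where B: "B \<ge> 0" "\<And>x. norm (?D x) \<le> B"
    using bounded_continuous_compact_support[OF D_cont D0] by blast
  have f_int: "integrable lebesgue f"
    by (rule integrable_lebesgueI[OF integrable_continuous_compact_support[OF f_cont R]])
  let ?q = "\<lambda>n x. (f (t n *\<^sub>R v + x) - f x) /\<^sub>R t n"
  have q_cont: "continuous_on UNIV (?q n)" for n
    by (intro continuous_intros continuous_on_compose2[OF f_cont]) auto
  have lim: "(\<lambda>n. fourier (?q n) \<xi>) \<longlonglongrightarrow> fourier ?D \<xi>"
    unfolding fourier_def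
  proof (rule integral_dominated_convergence[where w="\<lambda>x. B * indicator (cball 0 (R + norm v)) x"])
    show "(\<lambda>x. ?D x * ?e x) \<in> borel_measurable lebesgue"
      by (intro borel_measurable_lebesgue_continuous continuous_on_mult D_cont continuous_on_fourier_kernel)
    show "(\<lambda>x. ?q n x * ?e x) \<in> borel_measurable lebesgue" for n
      by (intro borel_measurable_lebesgue_continuous continuous_on_mult q_cont continuous_on_fourier_kernel)
    show "integrable lebesgue (\<lambda>x. B * indicator (cball 0 (R + norm v)) x)"
      by (intro integrable_mult_right integrable_real_indicator) (use emeasure_bounded_finite[OF bounded_cball[of 0 "R + norm v"]] in auto)
    show "AE x in lebesgue. norm (?q n x * ?e x) \<le> B * indicator (cball 0 (R + norm v)) x" for n
    proof (intro AE_I2)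
      fix x
      have "norm (?q n x) \<le> B"
      proof -
        have "norm (?q n x) = norm (f (x + t n *\<^sub>R v) - f x) / t n"
          using t(2)[of n] by (simp add: add.commute divide_inverse_commute)
        then show ?thesis
          using norm_difference_le_directional[OF f_diff B(2), of "t n" x] t(2)[of n]
          by (simp only: pos_divide_le_eq)
      qed
      moreover have "?q n x = 0" if "R + norm v < norm x"
      proof -
        have "t n * norm v \<le> norm v" using t(2,3)[of n] by (simp add: mult_left_le_one_le)
        moreover have "norm x \<le> norm (t n *\<^sub>R v + x) + t n * norm v"
          using norm_triangle_ineq4[of "t n *\<^sub>R v + x" "t n *\<^sub>R v"] t(2)[of n] by simp
        ultimately have "R < norm (t n *\<^sub>R v + x)" using that by linarith
        moreover have "R < norm x" using that norm_ge_zero[of v] by linarith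
        ultimately show ?thesis using R by simp
      qed
      ultimately show "norm (?q n x * ?e x) \<le> B * indicator (cball 0 (R + norm v)) x"
        by (cases "norm x \<le> R + norm v") (auto simp: norm_mult)
    qed
    show "AE x in lebesgue. (\<lambda>n. ?q n x * ?e x) \<longlonglongrightarrow> ?D x * ?e x"
    proof (intro AE_I2 tendsto_intros)
      fix x
      have "((\<lambda>s. f (s *\<^sub>R v + x)) has_derivative (\<lambda>h. frechet_derivative f (at (0 *\<^sub>R v + x)) (h *\<^sub>R v))) (at 0)"
        using f_diff frechet_derivative_works
        by (intro has_derivative_compose[of "\<lambda>s. s *\<^sub>R v + x" "\<lambda>h. h *\<^sub>R v" _ _ f]) (auto intro!: derivative_eq_intros)
      moreover have "frechet_derivative f (at x) (h *\<^sub>R v) = h *\<^sub>R ?D x" for h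
        using f_diff by (intro linear_scale linear_frechet_derivative)
      ultimately have "((\<lambda>s. f (s *\<^sub>R v + x)) has_derivative (\<lambda>h. h *\<^sub>R ?D x)) (at 0)"
        by simp
      then have "((\<lambda>s. norm (f (s *\<^sub>R v + x) - f x - s *\<^sub>R ?D x) / norm s) \<longlongrightarrow> 0) (at 0)"
        by (simp add: has_derivative_at)
      then have "((\<lambda>s. norm ((f (s *\<^sub>R v + x) - f x) /\<^sub>R s - ?D x)) \<longlongrightarrow> 0) (at 0)"
      proof (rule Lim_transform_eventually)
        have "norm (f (s *\<^sub>R v + x) - f x - s *\<^sub>R ?D x) / norm s = norm ((f (s *\<^sub>R v + x) - f x) /\<^sub>R s - ?D x)"
          if "s \<noteq> 0" for s
        proof -
          have "(f (s *\<^sub>R v + x) - f x) /\<^sub>R s - ?D x = (f (s *\<^sub>R v + x) - f x - s *\<^sub>R ?D x) /\<^sub>R s"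
            using that by (simp add: scaleR_right_diff_distrib)
          then show ?thesis by (simp add: divide_inverse_commute)
        qed
        then show "\<forall>\<^sub>F s in at 0. norm (f (s *\<^sub>R v + x) - f x - s *\<^sub>R ?D x) / norm s =
            norm ((f (s *\<^sub>R v + x) - f x) /\<^sub>R s - ?D x)"
          by (simp add: eventually_at_filter)
      qed
      then have "((\<lambda>s. (f (s *\<^sub>R v + x) - f x) /\<^sub>R s) \<longlongrightarrow> ?D x) (at 0)"
        by (simp add: tendsto_norm_zero_iff Lim_null[symmetric])
      moreover have "filterlim t (at 0) sequentially"
        using t by (auto simp: filterlim_at less_imp_neq[symmetric] intro!: always_eventually)
      ultimately show "(\<lambda>n. ?q n x) \<longlonglongrightarrow> ?D x"
        by (rule filterlim_compose)
    qed
  qed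
  \<comment> \<open>The same difference quotients, evaluated through translation invariance.\<close>
  have q_eq: "fourier (?q n) \<xi> = ((exp (2 * complex_of_real pi * \<i> * complex_of_real (v \<bullet> \<xi>) * complex_of_real (t n)) - 1) / complex_of_real (t n)) * fourier f \<xi>" for n
  proof -
    have int: "integrable lebesgue (\<lambda>x. f (t n *\<^sub>R v + x))"
      using integrable_lebesgue_affine[OF _ f_int, of 1 "t n *\<^sub>R v"] by simp
    have "fourier (?q n) \<xi> = fourier (\<lambda>x. f (t n *\<^sub>R v + x) - f x) \<xi> /\<^sub>R t n"
      unfolding fourier_def by (simp flip: integral_scaleR_right)
    also have "\<dots> = (fourier (\<lambda>x. f (t n *\<^sub>R v + x)) \<xi> - fourier f \<xi>) /\<^sub>R t n"
      by (simp add: fourier_diff[OF int f_int])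
    also have "\<dots> = ((exp (2 * complex_of_real pi * \<i> * complex_of_real (v \<bullet> \<xi>) * complex_of_real (t n)) - 1) / complex_of_real (t n)) * fourier f \<xi>"
      unfolding fourier_translate inner_scaleR_left of_real_mult using t(2)[of n] by (simp add: scaleR_conv_of_real field_simps)
    finally show ?thesis .
  qed
  have "((\<lambda>z. exp (2 * complex_of_real pi * \<i> * complex_of_real (v \<bullet> \<xi>) * z)) has_field_derivative
      2 * complex_of_real pi * \<i> * complex_of_real (v \<bullet> \<xi>)) (at 0)"
    by (auto intro!: derivative_eq_intros)
  then have "((\<lambda>z. (exp (2 * complex_of_real pi * \<i> * complex_of_real (v \<bullet> \<xi>) * z) - 1) / z) \<longlongrightarrow>
      2 * complex_of_real pi * \<i> * complex_of_real (v \<bullet> \<xi>)) (at 0)"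
    by (simp add: has_field_derivative_iff)
  moreover have "filterlim (\<lambda>n. complex_of_real (t n)) (at 0) sequentially"
    using t tendsto_of_real[OF t(1)] by (auto simp: filterlim_at less_imp_neq[symmetric] intro!: always_eventually)
  ultimately have "(\<lambda>n. (exp (2 * complex_of_real pi * \<i> * complex_of_real (v \<bullet> \<xi>) * complex_of_real (t n)) - 1) / complex_of_real (t n))
    \<longlonglongrightarrow> 2 * complex_of_real pi * \<i> * complex_of_real (v \<bullet> \<xi>)"
    by (rule filterlim_compose)
  then have "(\<lambda>n. fourier (?q n) \<xi>) \<longlonglongrightarrow> 2 * complex_of_real pi * \<i> * complex_of_real (v \<bullet> \<xi>) * fourier f \<xi>"
    unfolding q_eq by (intro tendsto_mult_right)
  then show ?thesis using lim LIMSEQ_unique by blast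
qed

text \<open>Each derivative in direction \<open>v\<close> gains one factor \<open>2 \<pi> |v \<bullet> \<xi>|\<close>.\<close>

lemma fourier_directional_decay:
  fixes f :: "real^'n \<Rightarrow> complex"
  assumes "Ck_on k UNIV f" and "\<And>x. R < norm x \<Longrightarrow> f x = 0"
  shows "\<exists>C. \<forall>\<xi>. \<bar>v \<bullet> \<xi>\<bar> ^ k * norm (fourier f \<xi>) \<le> C"
  using assms
proof (induction k arbitrary: f)
  case 0
  have "integrable lebesgue f"
    using 0 integrable_lebesgueI[OF integrable_continuous_compact_support[of f R]] by auto
  then show ?case using norm_fourier_le by auto
next
  case (Suc k)
  have "Ck_on k UNIV (\<lambda>x. frechet_derivative f (at x) v)" using Suc.prems(1) by simp
  then obtain C where C: "\<bar>v \<bullet> \<xi>\<bar> ^ k * norm (fourier (\<lambda>x. frechet_derivative f (at x) v) \<xi>) \<le> C" for \<xi>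
    using Suc.IH C1_compact_support_derivative[of R f, OF Suc.prems(2)] by blast
  have "Ck_on (Suc 0) UNIV f"
    using Suc.prems(1) Ck_on_imp_continuous_on[OF Ck_on_SucD(2)[OF Suc.prems(1)]] by auto
  then have eq: "fourier (\<lambda>x. frechet_derivative f (at x) v) \<xi> =
      2 * complex_of_real pi * \<i> * complex_of_real (v \<bullet> \<xi>) * fourier f \<xi>" for \<xi>
    using fourier_frechet_derivative[of f R v \<xi>] Suc.prems(2) by blast
  have "\<bar>v \<bullet> \<xi>\<bar> ^ Suc k * norm (fourier f \<xi>) \<le> C" for \<xi>
  proof -
    have "\<bar>v \<bullet> \<xi>\<bar> ^ Suc k * norm (fourier f \<xi>) = 1 * (\<bar>v \<bullet> \<xi>\<bar> ^ Suc k * norm (fourier f \<xi>))" by simp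
    also have "\<dots> \<le> (2 * pi) * (\<bar>v \<bullet> \<xi>\<bar> ^ Suc k * norm (fourier f \<xi>))"
      using pi_ge_two by (intro mult_right_mono) auto
    also have "\<dots> = \<bar>v \<bullet> \<xi>\<bar> ^ k * norm (fourier (\<lambda>x. frechet_derivative f (at x) v) \<xi>)"
      unfolding eq by (simp add: norm_mult)
    also have "\<dots> \<le> C" by (rule C)
    finally show ?thesis .
  qed
  then show ?case by blast
qed

text \<open>The coordinate of \<open>\<xi>\<close> of largest modulus is comparable to \<open>|\<xi>|\<close>, so the decay in the
  coordinate directions adds up to isotropic decay. The number \<open>1\<close> is thrown in with the coordinates to cover small \<open>\<xi>\<close>.\<close>

lemma fourier_decay:
  fixes f :: "real^'n \<Rightarrow> complex"
  assumes f: "Ck_on k UNIV f" and R: "\<And>x. R < norm x \<Longrightarrow> f x = 0"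
  obtains C where "C \<ge> 0" "\<And>\<xi>. norm (fourier f \<xi>) \<le> C / (1 + norm \<xi>) ^ k"
proof -
  have "\<exists>C. \<forall>\<xi>. \<bar>v \<bullet> \<xi>\<bar> ^ k * norm (fourier f \<xi>) \<le> C" for v
    using fourier_directional_decay[OF f R] .
  then obtain C where C: "\<bar>v \<bullet> \<xi>\<bar> ^ k * norm (fourier f \<xi>) \<le> C v" for v \<xi> by metis
  have "Ck_on 0 UNIV f" using Ck_on_imp_continuous_on[OF f] by simp
  then obtain C0 where C0: "norm (fourier f \<xi>) \<le> C0" for \<xi>
    using fourier_directional_decay[where k=0 and f=f and R=R] R by auto
  let ?n = "real (DIM(real^'n))"
  define M where "M = (?n + 1) ^ k * (C0 + (\<Sum>v\<in>Basis. C v))"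
  have bound: "(1 + norm \<xi>) ^ k * norm (fourier f \<xi>) \<le> M" for \<xi>
  proof -
    let ?S = "insert 1 ((\<lambda>v. \<bar>v \<bullet> \<xi>\<bar>) ` (Basis :: (real^'n) set))"
    define m where "m = Max ?S"
    have m: "1 \<le> m" "\<And>v. v \<in> Basis \<Longrightarrow> \<bar>v \<bullet> \<xi>\<bar> \<le> m" and mS: "m \<in> ?S"
      unfolding m_def
      by (rule Max_ge, simp, blast)+ (rule Max_in, auto)
    have "norm \<xi> \<le> (\<Sum>v\<in>Basis. \<bar>\<xi> \<bullet> v\<bar>)" by (rule norm_le_l1)
    also have "\<dots> \<le> (\<Sum>v\<in>(Basis :: (real^'n) set). m)"
      using m(2) by (intro sum_mono) (simp add: inner_commute)
    finally have "1 + norm \<xi> \<le> (?n + 1) * m" using m(1) by (simp add: distrib_right)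
    then have "(1 + norm \<xi>) ^ k \<le> ((?n + 1) * m) ^ k" by (intro power_mono) auto
    then have "(1 + norm \<xi>) ^ k * norm (fourier f \<xi>) \<le> (?n + 1) ^ k * (m ^ k * norm (fourier f \<xi>))"
      by (subst mult.assoc[symmetric], subst power_mult_distrib[symmetric], intro mult_right_mono) auto
    also have "m ^ k * norm (fourier f \<xi>) \<le> C0 + (\<Sum>v\<in>Basis. C v)"
    proof -
      have C_ge: "0 \<le> C v" for v
        using C[of v 0] by (meson norm_ge_zero mult_nonneg_nonneg abs_ge_zero zero_le_power order_trans)
      have "0 \<le> C0" using C0[of 0] norm_ge_zero order_trans by blast
      from mS consider "m = 1" | v where "v \<in> Basis" "m = \<bar>v \<bullet> \<xi>\<bar>" by auto
      then show ?thesis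
      proof cases
        case 1
        then show ?thesis using C0[of \<xi>] sum_nonneg[of Basis C] C_ge by fastforce
      next
        case 2
        then have "m ^ k * norm (fourier f \<xi>) \<le> C v" using C by simp
        also have "\<dots> \<le> (\<Sum>v\<in>Basis. C v)" using 2 C_ge by (intro member_le_sum) auto
        finally show ?thesis using \<open>0 \<le> C0\<close> by simp
      qed
    qed
    finally show ?thesis unfolding M_def by (simp add: mult_left_mono)
  qed
  show ?thesis
  proof (rule that[of M])
    show "0 \<le> M" using order_trans[OF norm_ge_zero bound[of 0, simplified]] .
    show "norm (fourier f \<xi>) \<le> M / (1 + norm \<xi>) ^ k" for \<xi>
      using bound[of \<xi>] by (simp add: add_pos_nonneg pos_le_divide_eq mult.commute)
  qed
qed

section \<open>The Gaussian and its Fourier transform\<close>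

text \<open>Lebesgue measure is the image of a product of one-dimensional Lebesgue measures, which splits integrals of
  products of functions of single coordinates.\<close>

lemma lborel_integral_prod_Basis:
  fixes f :: "'a::euclidean_space \<Rightarrow> real \<Rightarrow> complex"
  assumes f: "\<And>b. b \<in> Basis \<Longrightarrow> integrable lborel (f b)"
  shows "integrable lborel (\<lambda>x::'a. \<Prod>b\<in>Basis. f b (x \<bullet> b))"
    and "(LINT x|lborel. (\<Prod>b\<in>Basis. f b (x \<bullet> b))) = (\<Prod>b\<in>Basis. LINT s|lborel. f b s)"
proof -
  interpret product_sigma_finite "\<lambda>_. lborel :: real measure" ..
  let ?T = "\<lambda>g :: 'a \<Rightarrow> real. \<Sum>b\<in>Basis. g b *\<^sub>R b"
  have T: "?T \<in> measurable (\<Pi>\<^sub>M b\<in>Basis. lborel) borel" by measurable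
  have meas: "(\<lambda>x::'a. \<Prod>b\<in>Basis. f b (x \<bullet> b)) \<in> borel_measurable borel"
  proof (intro borel_measurable_prod)
    fix b :: 'a assume "b \<in> Basis"
    then have "f b \<in> borel_measurable borel" using borel_measurable_integrable[OF f] by simp
    then show "(\<lambda>x. f b (x \<bullet> b)) \<in> borel_measurable borel" by measurable
  qed
  have comp: "(\<Prod>b\<in>Basis. f b (?T g \<bullet> b)) = (\<Prod>b\<in>Basis. f b (g b))" for g
    by (intro prod.cong) auto
  show "integrable lborel (\<lambda>x::'a. \<Prod>b\<in>Basis. f b (x \<bullet> b))"
    by (subst lborel_eq, subst integrable_distr_eq[OF T meas], unfold comp)
       (intro product_integrable_prod finite_Basis f)
  show "(LINT x|lborel. (\<Prod>b\<in>Basis. f b (x \<bullet> b))) = (\<Prod>b\<in>Basis. LINT s|lborel. f b s)"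
    by (subst lborel_eq, subst integral_distr[OF T meas], unfold comp)
       (intro product_integral_prod finite_Basis f)
qed

text \<open>This is the characteristic function of the standard normal distribution, freed from its normalisation.\<close>

lemma gaussian_integral_1:
  "integrable lborel (\<lambda>s::real. complex_of_real (exp (- s\<^sup>2 / 2)) * exp (\<i> * complex_of_real (t * s)))"
  "(LINT s|lborel. complex_of_real (exp (- s\<^sup>2 / 2)) * exp (\<i> * complex_of_real (t * s))) =
     complex_of_real (sqrt (2 * pi) * exp (- t\<^sup>2 / 2))"
proof -
  have eq: "complex_of_real (exp (- s\<^sup>2 / 2)) * exp (\<i> * complex_of_real (t * s)) =
      sqrt (2 * pi) *\<^sub>R (std_normal_density s *\<^sub>R iexp (t * s))" for s
    by (simp add: std_normal_density_def scaleR_conv_of_real)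
  have int: "integrable lborel (\<lambda>s. std_normal_density s *\<^sub>R iexp (t * s))"
  proof (rule Bochner_Integration.integrable_bound[of _ std_normal_density])
    show "integrable lborel std_normal_density" by (rule integrable_normal_density) simp
  qed (auto simp: normal_density_nonneg)
  then show "integrable lborel (\<lambda>s::real. complex_of_real (exp (- s\<^sup>2 / 2)) * exp (\<i> * complex_of_real (t * s)))"
    unfolding eq by (intro integrable_scaleR_right)
  have "char std_normal_distribution t = (LINT s|lborel. std_normal_density s *\<^sub>R iexp (t * s))"
    unfolding char_def by (subst integral_density) (auto simp: normal_density_nonneg)
  then show "(LINT s|lborel. complex_of_real (exp (- s\<^sup>2 / 2)) * exp (\<i> * complex_of_real (t * s))) =
     complex_of_real (sqrt (2 * pi) * exp (- t\<^sup>2 / 2))"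
    unfolding eq integral_scaleR_right by (simp add: char_std_normal_distribution scaleR_conv_of_real)
qed

lemma gaussian_fourier:
  fixes \<xi> :: "real^'n"
  shows "integrable lebesgue (\<lambda>x::real^'n. complex_of_real (exp (- (norm x)\<^sup>2 / 2)))"
    and "fourier (\<lambda>x::real^'n. complex_of_real (exp (- (norm x)\<^sup>2 / 2))) \<xi> =
      complex_of_real (sqrt (2 * pi) ^ CARD('n) * exp (- (2 * pi)\<^sup>2 * (norm \<xi>)\<^sup>2 / 2))"
proof -
  let ?g = "\<lambda>t s::real. complex_of_real (exp (- s\<^sup>2 / 2)) * exp (\<i> * complex_of_real (t * s))"
  have nrm: "(norm x)\<^sup>2 = (\<Sum>b\<in>Basis. (x \<bullet> b)\<^sup>2)" for x :: "real^'n"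
    unfolding power2_norm_eq_inner by (subst euclidean_inner) (simp add: power2_eq_square)
  have eq: "(\<Prod>b\<in>Basis. ?g (- 2 * pi * (\<xi> \<bullet> b)) (x \<bullet> b)) =
      complex_of_real (exp (- (norm x)\<^sup>2 / 2)) * exp (- (2 * complex_of_real pi * \<i> * complex_of_real (x \<bullet> \<xi>)))"
    for x \<xi> :: "real^'n"
  proof -
    have "(\<Sum>b\<in>Basis. \<i> * complex_of_real (- 2 * pi * (\<xi> \<bullet> b) * (x \<bullet> b))) =
        \<i> * complex_of_real (- 2 * pi * (\<Sum>b\<in>Basis. (x \<bullet> b) * (\<xi> \<bullet> b)))"
      unfolding sum_distrib_left of_real_sum by (intro sum.cong refl) simp
    also have "(\<Sum>b\<in>Basis. (x \<bullet> b) * (\<xi> \<bullet> b)) = x \<bullet> \<xi>" by (rule euclidean_inner[symmetric])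
    finally have *: "(\<Sum>b\<in>Basis. \<i> * complex_of_real (- 2 * pi * (\<xi> \<bullet> b) * (x \<bullet> b))) =
      - (2 * complex_of_real pi * \<i> * complex_of_real (x \<bullet> \<xi>))" by simp
    have **: "(\<Prod>b\<in>Basis. complex_of_real (exp (- (x \<bullet> b)\<^sup>2 / 2))) = complex_of_real (exp (- (norm x)\<^sup>2 / 2))"
      unfolding nrm of_real_prod[symmetric] exp_sum[OF finite_Basis, symmetric]
      by (simp add: sum_divide_distrib sum_negf)
    show ?thesis
      unfolding prod.distrib ** exp_sum[OF finite_Basis, symmetric] * ..
  qed
  have int: "integrable lborel (\<lambda>x. complex_of_real (exp (- (norm x)\<^sup>2 / 2)) *
      exp (- (2 * complex_of_real pi * \<i> * complex_of_real (x \<bullet> \<xi>))))" for \<xi> :: "real^'n"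
    using lborel_integral_prod_Basis(1)[of "\<lambda>b. ?g (- 2 * pi * (\<xi> \<bullet> b))", OF gaussian_integral_1(1)]
    unfolding eq .
  from integrable_lebesgueI[OF int[of 0]]
  show "integrable lebesgue (\<lambda>x::real^'n. complex_of_real (exp (- (norm x)\<^sup>2 / 2)))" by simp
  have "fourier (\<lambda>x::real^'n. complex_of_real (exp (- (norm x)\<^sup>2 / 2))) \<xi> =
      (LINT x|lborel. (\<Prod>b\<in>Basis. ?g (- 2 * pi * (\<xi> \<bullet> b)) (x \<bullet> b)))"
    unfolding fourier_def eq
    by (rule integral_completion) (rule borel_measurable_integrable[OF int])
  also have "\<dots> = (\<Prod>b\<in>(Basis :: (real^'n) set). complex_of_real (sqrt (2 * pi) * exp (- (2 * pi)\<^sup>2 * (\<xi> \<bullet> b)\<^sup>2 / 2)))"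
    by (subst lborel_integral_prod_Basis(2)[OF gaussian_integral_1(1)], unfold gaussian_integral_1(2))
       (intro prod.cong refl arg_cong[where f=complex_of_real] arg_cong2[where f="(*)"] arg_cong[where f=exp],
        simp add: power2_eq_square)
  also have "\<dots> = complex_of_real (sqrt (2 * pi) ^ CARD('n) * exp (- (2 * pi)\<^sup>2 * (norm \<xi>)\<^sup>2 / 2))"
    unfolding of_real_prod[symmetric] prod.distrib nrm exp_sum[OF finite_Basis, symmetric]
    by (simp add: sum_distrib_left sum_divide_distrib sum_negf)
  finally show "fourier (\<lambda>x::real^'n. complex_of_real (exp (- (norm x)\<^sup>2 / 2))) \<xi> =
      complex_of_real (sqrt (2 * pi) ^ CARD('n) * exp (- (2 * pi)\<^sup>2 * (norm \<xi>)\<^sup>2 / 2))" .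
qed

text \<open>The transform of the Gaussian has total mass \<open>1\<close>, which lets it serve as an approximate identity in the proof of
  the inversion theorem.\<close>

lemma integral_fourier_gaussian:
  defines "\<gamma> \<equiv> \<lambda>x::real^'n. complex_of_real (exp (- (norm x)\<^sup>2 / 2))"
  shows "integrable lebesgue (fourier \<gamma>)" and "(LINT \<xi>|lebesgue. fourier \<gamma> \<xi>) = 1"
proof -
  have eq: "fourier \<gamma> = (\<lambda>\<xi>. complex_of_real (sqrt (2 * pi) ^ CARD('n)) * \<gamma> (0 + (2 * pi) *\<^sub>R \<xi>))"
    unfolding \<gamma>_def gaussian_fourier(2) by (simp add: fun_eq_iff power_mult_distrib)
  have int: "integrable lebesgue \<gamma>" unfolding \<gamma>_def by (rule gaussian_fourier(1))
  show "integrable lebesgue (fourier \<gamma>)"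
    unfolding eq by (intro integrable_mult_right integrable_lebesgue_affine int) auto
  have "fourier \<gamma> 0 = (LINT x|lebesgue. \<gamma> x)" by (simp add: fourier_def)
  also have "\<dots> = \<bar>2 * pi\<bar> ^ DIM(real^'n) *\<^sub>R (LINT \<xi>|lebesgue. \<gamma> (0 + (2 * pi) *\<^sub>R \<xi>))"
    by (rule integral_lebesgue_affine) simp
  also have "fourier \<gamma> 0 = complex_of_real (sqrt (2 * pi) ^ CARD('n))"
    unfolding \<gamma>_def gaussian_fourier(2) by simp
  finally have "complex_of_real (sqrt (2 * pi) ^ CARD('n)) * complex_of_real (sqrt (2 * pi) ^ CARD('n)) =
     complex_of_real ((2 * pi) ^ CARD('n)) * (LINT \<xi>|lebesgue. fourier \<gamma> \<xi>)"
    unfolding eq by (simp add: scaleR_conv_of_real)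
  moreover have "complex_of_real (sqrt (2 * pi) ^ CARD('n)) * complex_of_real (sqrt (2 * pi) ^ CARD('n)) = complex_of_real ((2 * pi) ^ CARD('n))"
  proof -
    have "sqrt (2 * pi) ^ CARD('n) * sqrt (2 * pi) ^ CARD('n) = (2 * pi) ^ CARD('n)"
      by (simp only: power_mult_distrib[symmetric] real_sqrt_mult_self) simp
    then show ?thesis by (simp only: of_real_mult[symmetric])
  qed
  ultimately show "(LINT \<xi>|lebesgue. fourier \<gamma> \<xi>) = 1" by simp
qed

section \<open>Multiplication formula, convolution and inversion\<close>

text \<open>Fubini's theorem is about product \<open>\<sigma>\<close>-algebras, and the product of two completed measures is not complete. Lebesgue
  measurable functions are therefore replaced by Borel representatives first.\<close>

lemma completion_ex_borel_complex:
  fixes f :: "'a \<Rightarrow> complex"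
  assumes [measurable]: "f \<in> borel_measurable (completion M)"
  obtains f' where "f' \<in> borel_measurable M" "AE x in M. f x = f' x"
proof -
  obtain r where r: "r \<in> borel_measurable M" "AE x in M. Re (f x) = r x"
    using completion_ex_borel_measurable_real[of "\<lambda>x. Re (f x)" M] by auto
  obtain i where i: "i \<in> borel_measurable M" "AE x in M. Im (f x) = i x"
    using completion_ex_borel_measurable_real[of "\<lambda>x. Im (f x)" M] by auto
  show ?thesis
  proof (rule that[of "\<lambda>x. Complex (r x) (i x)"])
    show "(\<lambda>x. Complex (r x) (i x)) \<in> borel_measurable M"
      unfolding Complex_eq using r(1) i(1) by measurable
    show "AE x in M. f x = Complex (r x) (i x)"
      using r(2) i(2) by eventually_elim (simp add: complex_eq_iff)
  qed
qed

lemma integrable_ex_borel: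
  fixes f :: "'a::euclidean_space \<Rightarrow> complex"
  assumes "integrable lebesgue f"
  obtains f' where "integrable lborel f'" "AE x in lebesgue. f x = f' x"
proof -
  obtain f' where f': "f' \<in> borel_measurable lborel" "AE x in lborel. f x = f' x"
    using completion_ex_borel_complex[OF borel_measurable_integrable[OF assms]] .
  have ae: "AE x in lebesgue. f x = f' x" using f'(2) by (rule AE_completion)
  have "integrable lebesgue f'"
    using assms f'(1) ae by (subst integrable_cong_AE[OF _ borel_measurable_integrable[OF assms]])
      (auto simp: eq_commute measurable_completion elim: eventually_mono)
  then show ?thesis using that ae f'(1) integrable_completion by blast
qed

lemma fourier_cong_AE:
  assumes "integrable lebesgue f" "integrable lebesgue g" and "AE x in lebesgue. f x = g x"
  shows "fourier f \<xi> = fourier g \<xi>"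
  unfolding fourier_def
  by (intro integral_cong_AE borel_measurable_integrable integrable_mult_fourier_kernel assms)
     (use assms(3) in eventually_elim, simp)

lemma integrable_mult_bounded_continuous:
  fixes f g :: "'a::euclidean_space \<Rightarrow> complex"
  assumes "integrable lebesgue f" and "continuous_on UNIV g" and "\<And>x. norm (g x) \<le> B"
  shows "integrable lebesgue (\<lambda>x. f x * g x)"
proof (rule Bochner_Integration.integrable_bound)
  show "integrable lebesgue (\<lambda>x. B *\<^sub>R f x)" using assms(1) by simp
  show "(\<lambda>x. f x * g x) \<in> borel_measurable lebesgue"
    by (intro borel_measurable_times borel_measurable_integrable[OF assms(1)]
        borel_measurable_lebesgue_continuous assms(2))
  show "AE x in lebesgue. norm (f x * g x) \<le> norm (B *\<^sub>R f x)"
  proof (intro AE_I2)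
    fix x
    have "norm (g x) \<le> \<bar>B\<bar>" using assms(3)[of x] by simp
    then show "norm (f x * g x) \<le> norm (B *\<^sub>R f x)"
      by (simp add: norm_mult mult.commute[of "norm (f x)"] mult_right_mono)
  qed
qed

lemma integrable_mult_fourier:
  fixes f h :: "real^'n \<Rightarrow> complex"
  assumes "integrable lebesgue f" "integrable lebesgue h"
  shows "integrable lebesgue (\<lambda>x. f x * fourier h x)"
  by (rule integrable_mult_bounded_continuous[OF assms(1) continuous_fourier[OF assms(2)] norm_fourier_le[OF assms(2)]])

text \<open>Fubini. Both places where a double integral occurs reduce to this formula: the convolution with an inverse
  transform and the Gaussian regularisation in the inversion theorem.\<close>

lemma fourier_multiplication_formula:
  fixes f h :: "real^'n \<Rightarrow> complex"
  assumes f: "integrable lebesgue f" and h: "integrable lebesgue h"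
  shows "(LINT x|lebesgue. f x * fourier h x) = (LINT x|lebesgue. fourier f x * h x)"
proof -
  let ?e = "\<lambda>x \<xi> :: real^'n. exp (- (2 * complex_of_real pi * \<i> * complex_of_real (x \<bullet> \<xi>)))"
  obtain f' where f': "integrable lborel f'" "AE x in lebesgue. f x = f' x" using integrable_ex_borel[OF f] .
  obtain h' where h': "integrable lborel h'" "AE x in lebesgue. h x = h' x" using integrable_ex_borel[OF h] .
  have f'_leb: "integrable lebesgue f'" and h'_leb: "integrable lebesgue h'"
    using f'(1) h'(1) by (auto intro: integrable_lebesgueI)
  have [measurable]: "f' \<in> borel_measurable borel" "h' \<in> borel_measurable borel"
    using f'(1) h'(1) borel_measurable_integrable by fastforce+
  have F: "fourier f = fourier f'" "fourier h = fourier h'"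
    using fourier_cong_AE[OF f f'_leb f'(2)] fourier_cong_AE[OF h h'_leb h'(2)] by auto
  have e_meas[measurable]: "(\<lambda>z. ?e (fst z) (snd z)) \<in> borel_measurable borel"
    by (intro borel_measurable_continuous_onI continuous_intros)
  let ?k = "\<lambda>x y. f' x * h' y * ?e y x"
  have k_meas: "case_prod ?k \<in> borel_measurable (lborel \<Otimes>\<^sub>M lborel)"
  proof -
    have e2: "(\<lambda>z. ?e (snd z) (fst z)) \<in> borel_measurable ((borel :: (real^'n) measure) \<Otimes>\<^sub>M (borel :: (real^'n) measure))"
      unfolding borel_prod by (intro borel_measurable_continuous_onI continuous_intros)
    show ?thesis using e2 unfolding case_prod_beta by measurable
  qed
  have k_int: "integrable (lborel \<Otimes>\<^sub>M lborel) (case_prod ?k)"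
  proof (rule lborel_pair.Fubini_integrable[OF k_meas])
    show "integrable lborel (\<lambda>x. LINT y|lborel. norm (case_prod ?k (x, y)))"
      using f'(1) by (simp add: norm_mult)
    have "integrable lborel (\<lambda>y. f' x * h' y * ?e y x)" for x
    proof (rule Bochner_Integration.integrable_bound[of _ "\<lambda>y. f' x * h' y"])
      show "(\<lambda>y. f' x * h' y * ?e y x) \<in> borel_measurable lborel"
        using measurable_fourier_kernel[of x] by measurable
    qed (use h'(1) in \<open>auto simp: norm_mult\<close>)
    then show "AE x in lborel. integrable lborel (\<lambda>y. case_prod ?k (x, y))" by simp
  qed
  have four_f': "(LINT x|lborel. f' x * ?e x y) = fourier f' y" for y
    unfolding fourier_def using measurable_fourier_kernel[of y]
    by (intro integral_completion[symmetric]) measurable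
  have four_h': "(LINT x|lborel. h' x * ?e x y) = fourier h' y" for y
    unfolding fourier_def using measurable_fourier_kernel[of y]
    by (intro integral_completion[symmetric]) measurable
  have F_meas: "fourier f' \<in> borel_measurable borel" "fourier h' \<in> borel_measurable borel"
    by (intro borel_measurable_continuous_onI continuous_fourier f'_leb h'_leb)+
  have "(LINT x|lebesgue. f x * fourier h x) = (LINT x|lebesgue. f' x * fourier h' x)"
    unfolding F using f'(2)
    by (intro integral_cong_AE borel_measurable_integrable integrable_mult_fourier f f'_leb h'_leb) (auto elim: eventually_mono)
  also have "\<dots> = (LINT x|lborel. f' x * fourier h' x)"
    using F_meas by (intro integral_completion borel_measurable_times) simp_all
  also have "\<dots> = (LINT x|lborel. LINT y|lborel. ?k x y)"
    by (simp add: four_h'[symmetric] mult.assoc)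
  also have "\<dots> = (LINT y|lborel. LINT x|lborel. ?k x y)"
    by (rule lborel_pair.Fubini_integral[OF k_int, symmetric])
  also have "\<dots> = (LINT y|lborel. fourier f' y * h' y)"
  proof (intro Bochner_Integration.integral_cong refl)
    fix y
    have "(LINT x|lborel. ?k x y) = (LINT x|lborel. (f' x * ?e x y) * h' y)"
      by (simp add: inner_commute mult_ac)
    also have "\<dots> = fourier f' y * h' y" unfolding four_f'[symmetric] by (rule integral_mult_left_zero)
    finally show "(LINT x|lborel. ?k x y) = fourier f' y * h' y" .
  qed
  also have "\<dots> = (LINT x|lebesgue. fourier f' x * h' x)"
    using F_meas by (intro integral_completion[symmetric] borel_measurable_times) simp_all
  also have "\<dots> = (LINT x|lebesgue. fourier f x * h x)"
  proof -
    have "integrable lebesgue (\<lambda>x. fourier f' x * h x)" "integrable lebesgue (\<lambda>x. fourier f' x * h' x)"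
      using integrable_mult_fourier[OF h f'_leb] integrable_mult_fourier[OF h'_leb f'_leb] by (simp_all add: mult.commute)
    then show ?thesis
      unfolding F using h'(2) by (intro integral_cong_AE borel_measurable_integrable) (auto elim: eventually_mono)
  qed
  finally show ?thesis .
qed

lemma fourier_modulate:
  fixes f :: "real^'n \<Rightarrow> complex"
  shows "fourier (\<lambda>\<zeta>. f \<zeta> * exp (- (2 * complex_of_real pi * \<i> * complex_of_real (\<zeta> \<bullet> x)))) y = fourier f (x + y)"
  unfolding fourier_def
  by (simp add: inner_add_right distrib_left exp_add exp_diff exp_minus field_simps)

text \<open>The convolution theorem, in the form where one factor is an inverse Fourier transform. It follows from the
  multiplication formula applied to \<open>f\<close> modulated by the frequency \<open>x\<close>, and it holds at every point \<open>x\<close>.\<close>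

lemma conv_fourier:
  fixes f h :: "real^'n \<Rightarrow> complex"
  assumes f: "integrable lebesgue f" and h: "integrable lebesgue h"
  shows "conv (\<lambda>x. fourier f (- x)) h x = fourier (\<lambda>\<zeta>. f \<zeta> * fourier h \<zeta>) (- x)"
proof -
  let ?g = "\<lambda>\<zeta>. f \<zeta> * exp (- (2 * complex_of_real pi * \<i> * complex_of_real (\<zeta> \<bullet> (- x))))"
  have g: "integrable lebesgue ?g" by (rule integrable_mult_fourier_kernel[OF f])
  have "conv (\<lambda>x. fourier f (- x)) h x = (LINT y|lebesgue. fourier ?g y * h y)"
    unfolding conv_def fourier_modulate by simp
  also have "\<dots> = (LINT \<zeta>|lebesgue. ?g \<zeta> * fourier h \<zeta>)"
    by (rule fourier_multiplication_formula[OF g h, symmetric])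
  also have "\<dots> = fourier (\<lambda>\<zeta>. f \<zeta> * fourier h \<zeta>) (- x)"
    unfolding fourier_def by (simp add: mult_ac)
  finally show ?thesis .
qed

lemma fourier_affine:
  fixes f :: "real^'n \<Rightarrow> complex"
  assumes "c \<noteq> 0"
  shows "\<bar>c\<bar> ^ CARD('n) *\<^sub>R fourier (\<lambda>u. f (v + c *\<^sub>R u)) (c *\<^sub>R x) =
     exp (2 * complex_of_real pi * \<i> * complex_of_real (v \<bullet> x)) * fourier f x"
proof -
  have "fourier (\<lambda>u. f (v + u)) x = \<bar>c\<bar> ^ CARD('n) *\<^sub>R fourier (\<lambda>u. f (v + c *\<^sub>R u)) (c *\<^sub>R x)"
    unfolding fourier_def by (subst integral_lebesgue_affine[OF assms, of _ 0]) simp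
  then show ?thesis by (simp add: fourier_translate)
qed

text \<open>Apply the multiplication formula to \<open>u \<mapsto> f (\<xi> + c u)\<close> and a Gaussian \<open>g\<close>. On one side, as \<open>c\<close> tends to \<open>0\<close>, the
  transform of \<open>g\<close> acts as an approximate identity and yields \<open>f \<xi>\<close>. On the other side, after
  rescaling, stands the inversion integral damped by \<open>g (c x)\<close>, and the damping disappears in the limit.\<close>

lemma fourier_inversion:
  fixes f :: "real^'n \<Rightarrow> complex"
  assumes cont: "continuous_on UNIV f" and R: "\<And>x. R < norm x \<Longrightarrow> f x = 0"
    and F: "integrable lebesgue (fourier f)"
  shows "fourier (\<lambda>x. fourier f (- x)) \<xi> = f \<xi>"
proof -
  let ?g = "\<lambda>x::real^'n. complex_of_real (exp (- (norm x)\<^sup>2 / 2))"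
  let ?e = "\<lambda>x. exp (2 * complex_of_real pi * \<i> * complex_of_real (\<xi> \<bullet> x))"
  define c where "c n = inverse (real (Suc n))" for n
  have c: "c \<longlonglongrightarrow> 0" "c n > 0" for n
    using LIMSEQ_inverse_real_of_nat by (auto simp: c_def[abs_def])
  obtain B where B: "B \<ge> 0" "\<And>x. norm (f x) \<le> B" 
    using bounded_continuous_compact_support[of f R] cont R by blast
  have f_int: "integrable lebesgue f"
    by (rule integrable_lebesgueI[OF integrable_continuous_compact_support[OF cont R]])
  have f_aff: "integrable lebesgue (\<lambda>u. f (\<xi> + c n *\<^sub>R u))" for n
    using integrable_lebesgue_affine[OF _ f_int] c(2)[of n] by simp
  note g = gaussian_fourier(1)[where 'n='n] and G = integral_fourier_gaussian[where 'n='n]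
  have e_cont: "continuous_on UNIV ?e" by (intro continuous_intros)
  have "(\<lambda>n. LINT u|lebesgue. f (\<xi> + c n *\<^sub>R u) * fourier ?g u) \<longlonglongrightarrow> (LINT u|lebesgue. f \<xi> * fourier ?g u)"
  proof (rule integral_dominated_convergence[where w="\<lambda>u. B * norm (fourier ?g u)"])
    show "AE u in lebesgue. (\<lambda>n. f (\<xi> + c n *\<^sub>R u) * fourier ?g u) \<longlonglongrightarrow> f \<xi> * fourier ?g u"
    proof (intro AE_I2 tendsto_intros)
      fix u
      have "(\<lambda>n. \<xi> + c n *\<^sub>R u) \<longlonglongrightarrow> \<xi> + 0 *\<^sub>R u" by (intro tendsto_intros c)
      then show "(\<lambda>n. f (\<xi> + c n *\<^sub>R u)) \<longlonglongrightarrow> f \<xi>"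
        using cont by (intro isCont_tendsto_compose[of \<xi> f]) (auto simp: continuous_on_eq_continuous_at)
    qed
    show "AE u in lebesgue. norm (f (\<xi> + c n *\<^sub>R u) * fourier ?g u) \<le> B * norm (fourier ?g u)" for n
      by (intro AE_I2) (simp add: norm_mult B mult_right_mono)
    show "integrable lebesgue (\<lambda>u. B * norm (fourier ?g u))" using G(1) by (intro integrable_mult_right integrable_norm)
    show "(\<lambda>u. f \<xi> * fourier ?g u) \<in> borel_measurable lebesgue"
      using borel_measurable_integrable[OF G(1)] by (intro borel_measurable_times) simp_all
    show "(\<lambda>u. f (\<xi> + c n *\<^sub>R u) * fourier ?g u) \<in> borel_measurable lebesgue" for n
      by (intro borel_measurable_integrable integrable_mult_fourier f_aff g)
  qed
  also have "(LINT u|lebesgue. f \<xi> * fourier ?g u) = f \<xi>" using G(2) by simp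
  also have "(\<lambda>n. LINT u|lebesgue. f (\<xi> + c n *\<^sub>R u) * fourier ?g u) =
     (\<lambda>n. LINT x|lebesgue. fourier f x * ?e x * ?g (c n *\<^sub>R x))"
  proof
    fix n
    have "(LINT u|lebesgue. f (\<xi> + c n *\<^sub>R u) * fourier ?g u) =
       (LINT x|lebesgue. fourier (\<lambda>u. f (\<xi> + c n *\<^sub>R u)) x * ?g x)"
      by (rule fourier_multiplication_formula[OF f_aff g])
    also have "\<dots> = \<bar>c n\<bar> ^ DIM(real^'n) *\<^sub>R (LINT x|lebesgue. fourier (\<lambda>u. f (\<xi> + c n *\<^sub>R u)) (0 + c n *\<^sub>R x) * ?g (0 + c n *\<^sub>R x))"
      using c(2)[of n] by (intro integral_lebesgue_affine) auto
    also have "\<dots> = (LINT x|lebesgue. (\<bar>c n\<bar> ^ CARD('n) *\<^sub>R fourier (\<lambda>u. f (\<xi> + c n *\<^sub>R u)) (c n *\<^sub>R x)) * ?g (c n *\<^sub>R x))"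
      by (simp flip: integral_scaleR_right)
    also have "\<dots> = (LINT x|lebesgue. fourier f x * ?e x * ?g (c n *\<^sub>R x))"
      using c(2)[of n] by (subst fourier_affine) (auto simp: mult_ac)
    finally show "(LINT u|lebesgue. f (\<xi> + c n *\<^sub>R u) * fourier ?g u) =
        (LINT x|lebesgue. fourier f x * ?e x * ?g (c n *\<^sub>R x))" .
  qed
  finally have lim1: "(\<lambda>n. LINT x|lebesgue. fourier f x * ?e x * ?g (c n *\<^sub>R x)) \<longlonglongrightarrow> f \<xi>" .
  have Fe: "integrable lebesgue (\<lambda>x. fourier f x * ?e x)"
    by (rule integrable_mult_bounded_continuous[OF F e_cont, of 1]) (simp add: norm_exp_eq_Re)
  have lim2: "(\<lambda>n. LINT x|lebesgue. fourier f x * ?e x * ?g (c n *\<^sub>R x)) \<longlonglongrightarrow> (LINT x|lebesgue. fourier f x * ?e x)"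
  proof (rule integral_dominated_convergence[where w="\<lambda>x. norm (fourier f x * ?e x)"])
    show "AE x in lebesgue. (\<lambda>n. fourier f x * ?e x * ?g (c n *\<^sub>R x)) \<longlonglongrightarrow> fourier f x * ?e x"
    proof (intro AE_I2)
      fix x
      have "(\<lambda>n. fourier f x * ?e x * ?g (c n *\<^sub>R x)) \<longlonglongrightarrow> fourier f x * ?e x * ?g (0 *\<^sub>R x)"
        by (intro tendsto_intros c) auto
      then show "(\<lambda>n. fourier f x * ?e x * ?g (c n *\<^sub>R x)) \<longlonglongrightarrow> fourier f x * ?e x" by simp
    qed
    show "AE x in lebesgue. norm (fourier f x * ?e x * ?g (c n *\<^sub>R x)) \<le> norm (fourier f x * ?e x)" for n
      by (intro AE_I2) (simp add: norm_mult mult_left_le)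
    show "(\<lambda>x. fourier f x * ?e x * ?g (c n *\<^sub>R x)) \<in> borel_measurable lebesgue" for n
      by (intro borel_measurable_times borel_measurable_integrable[OF F] borel_measurable_lebesgue_continuous continuous_intros) auto
  qed (use Fe in auto)
  have "fourier (\<lambda>x. fourier f (- x)) \<xi> = \<bar>-1\<bar> ^ DIM(real^'n) *\<^sub>R (LINT x|lebesgue.
      fourier f (- (0 + (-1) *\<^sub>R x)) * exp (- (2 * complex_of_real pi * \<i> * complex_of_real ((0 + (-1) *\<^sub>R x) \<bullet> \<xi>))))"
    unfolding fourier_def[of "\<lambda>x. fourier f (- x)"] by (rule integral_lebesgue_affine) simp
  also have "\<dots> = (LINT x|lebesgue. fourier f x * ?e x)" by (simp add: inner_commute)
  also have "\<dots> = f \<xi>" using LIMSEQ_unique[OF lim2 lim1] .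
  finally show ?thesis .
qed

section \<open>A dyadic resolution of unity through a Tauberian multiplier\<close>

text \<open>An interval whose endpoints have ratio \<open>2\<close> meets every dyadic orbit.\<close>

lemma dyadic_scale:
  fixes t a :: real
  assumes "t > 0" "a > 0"
  obtains j :: int where "a \<le> 2 powi j * t" "2 powi j * t \<le> 2 * a"
proof (rule that)
  define j where "j = \<lceil>log 2 (a / t)\<rceil>"
  have eq: "(2::real) powi j = 2 powr real_of_int j" by (simp add: powr_real_of_int')
  have at: "a / t = 2 powr log 2 (a / t)" using assms by simp
  have "2 powr log 2 (a / t) \<le> 2 powr real_of_int j" unfolding j_def by (intro powr_mono) auto
  then show "a \<le> 2 powi j * t" using at eq assms by (simp add: divide_simps)
  have "2 powr real_of_int j \<le> 2 powr (log 2 (a / t) + 1)" unfolding j_def by (intro powr_mono) linarith+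
  also have "\<dots> = 2 * (a / t)" using assms by (simp add: powr_add)
  finally show "2 powi j * t \<le> 2 * a" using eq assms by (simp add: divide_simps)
qed

text \<open>For each \<open>\<xi>\<close> with \<open>1 \<le> |\<xi>| \<le> 2\<close> the Tauberian segment on its ray contains some \<open>2\<^sup>j \<xi>\<close>, and \<open>\<xi>\<close> may be varied a
  little with the same \<open>j\<close>. By compactness finitely many \<open>j\<close> suffice, and every nonzero vector can be
  scaled dyadically into \<open>1 \<le> |\<xi>| \<le> 2\<close>.\<close>

lemma tauberian_annulus:
  fixes \<psi> :: "real^'n \<Rightarrow> complex"
  assumes cont: "continuous_on UNIV (fourier \<psi>)" and taub: "tauberian \<psi>"
  obtains A B :: real where "0 < A" "A \<le> B"
    "\<And>\<xi>. \<xi> \<noteq> 0 \<Longrightarrow> \<exists>j::int. A \<le> norm ((2 powi j :: real) *\<^sub>R \<xi>) \<and> norm ((2 powi j :: real) *\<^sub>R \<xi>) \<le> B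
        \<and> fourier \<psi> ((2 powi j :: real) *\<^sub>R \<xi>) \<noteq> 0"
proof -
  define K where "K = {\<xi> :: real^'n. 1 \<le> norm \<xi> \<and> norm \<xi> \<le> 2}"
  define U where "U j = {\<xi>. fourier \<psi> ((2 powi j :: real) *\<^sub>R \<xi>) \<noteq> 0}" for j :: int
  have "K = cball 0 2 - ball 0 1" by (auto simp: K_def)
  then have "compact K" by (simp add: compact_diff)
  moreover have "open (U j)" for j
  proof -
    have "continuous_on UNIV (\<lambda>\<xi>. fourier \<psi> ((2 powi j :: real) *\<^sub>R \<xi>))"
      by (intro continuous_on_compose2[OF cont] continuous_intros) auto
    then show ?thesis unfolding U_def by (intro open_Collect_neq continuous_intros)
  qed
  moreover have "K \<subseteq> (\<Union>j\<in>UNIV. U j)"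
  proof
    fix \<xi> assume "\<xi> \<in> K"
    then have n: "norm \<xi> > 0" by (auto simp: K_def)
    then have "\<xi> /\<^sub>R norm \<xi> \<in> sphere 0 1" by simp
    then obtain a b :: real where ab: "0 < 2 * a" "2 * a \<le> b"
      "\<And>t. t \<in> {a..b} \<Longrightarrow> cmod (fourier \<psi> (t *\<^sub>R (\<xi> /\<^sub>R norm \<xi>))) > 0"
      using taub unfolding tauberian_def by blast
    \<comment> \<open>The Tauberian segment is at least [a, 2 a], which leaves room for a dyadic multiple of the norm.\<close>
    obtain j where "a \<le> 2 powi j * norm \<xi>" "2 powi j * norm \<xi> \<le> 2 * a"
      using dyadic_scale[of "norm \<xi>" a] n ab by auto
    then have "cmod (fourier \<psi> ((2 powi j * norm \<xi>) *\<^sub>R (\<xi> /\<^sub>R norm \<xi>))) > 0"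
      using ab by (intro ab(3)) auto
    moreover have "(2 powi j * norm \<xi>) *\<^sub>R (\<xi> /\<^sub>R norm \<xi>) = (2 powi j :: real) *\<^sub>R \<xi>"
      using n by simp
    ultimately have "\<xi> \<in> U j" by (simp only: U_def mem_Collect_eq zero_less_norm_iff not_False_eq_True)
    then show "\<xi> \<in> (\<Union>j\<in>UNIV. U j)" by blast
  qed
  ultimately obtain J where J: "finite J" "K \<subseteq> (\<Union>j\<in>J. U j)"
    by (rule compactE_image) blast
  have "(\<lambda>x. x *\<^sub>R (SOME b :: real^'n. b \<in> Basis)) 1 \<in> K"
    using some_in_eq[of "Basis :: (real^'n) set"] by (auto simp: K_def)
  then have "J \<noteq> {}" using J by blast
  define m M where "m = Min J" and "M = Max J"
  show thesis
  proof (rule that[of "2 powi m" "2 * 2 powi M"])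
    have "m \<le> M" unfolding m_def M_def using J(1) \<open>J \<noteq> {}\<close> by simp
    then have "(2::real) powi m \<le> 2 powi M" by (intro power_int_increasing) auto
    moreover have "(2::real) powi M > 0" by simp
    ultimately show "(2::real) powi m \<le> 2 * 2 powi M" by linarith
    fix \<xi> :: "real^'n" assume "\<xi> \<noteq> 0"
    then obtain i where i: "1 \<le> 2 powi i * norm \<xi>" "2 powi i * norm \<xi> \<le> 2"
      using dyadic_scale[of "norm \<xi>" 1] by auto
    then have "(2 powi i :: real) *\<^sub>R \<xi> \<in> K" by (simp add: K_def)
    then obtain j where j: "j \<in> J" "(2 powi i :: real) *\<^sub>R \<xi> \<in> U j" using J by blast
    have mj: "m \<le> j" "j \<le> M" unfolding m_def M_def using J(1) j(1) by simp_all
    have pw: "(2 powi (j + i) :: real) = 2 powi j * 2 powi i" by (simp add: power_int_add)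
    have "2 powi m * 1 \<le> 2 powi j * (2 powi i * norm \<xi>)"
      using i mj by (intro mult_mono power_int_increasing) auto
    moreover have "2 powi j * (2 powi i * norm \<xi>) \<le> 2 powi M * 2"
      using i mj by (intro mult_mono power_int_increasing) auto
    ultimately show "\<exists>j::int. 2 powi m \<le> norm ((2 powi j :: real) *\<^sub>R \<xi>) \<and>
        norm ((2 powi j :: real) *\<^sub>R \<xi>) \<le> 2 * 2 powi M \<and> fourier \<psi> ((2 powi j :: real) *\<^sub>R \<xi>) \<noteq> 0"
      using j(2) by (intro exI[of _ "j + i"]) (simp add: pw U_def mult_ac)
  qed auto
qed

definition annulus_bump :: "nat \<Rightarrow> real \<Rightarrow> real \<Rightarrow> 'a::euclidean_space \<Rightarrow> real" where
  "annulus_bump k r R \<xi> = max 0 (\<xi> \<bullet> \<xi> - r\<^sup>2) ^ (k+1) * max 0 (R\<^sup>2 - \<xi> \<bullet> \<xi>) ^ (k+1)"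

lemma Ck_on_norm_square:
  fixes S :: "'a::euclidean_space set"
  assumes "open S" shows "Ck_on k S (\<lambda>\<xi>. \<xi> \<bullet> \<xi>)"
proof (cases k)
  case (Suc m)
  have "Ck_on m S (\<lambda>\<xi>. 2 * (\<xi> \<bullet> v))" for v
    by (intro Ck_on_bounded_linear assms) (simp add: bounded_linear_const_mult bounded_linear_inner_left)
  moreover have "((\<lambda>\<xi>. \<xi> \<bullet> \<xi>) has_derivative (\<lambda>v. 2 * (\<xi> \<bullet> v))) (at \<xi>)" for \<xi> :: 'a
    by (auto intro!: derivative_eq_intros simp: inner_commute)
  ultimately show ?thesis unfolding Suc using assms by (intro Ck_on_SucI) auto
qed (auto intro!: continuous_intros)

lemma Ck_on_annulus_bump:
  "Ck_on k UNIV (\<lambda>\<xi>::'a::euclidean_space. annulus_bump k r R \<xi>)"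
proof -
  have "Ck_on k UNIV (\<lambda>\<xi>::'a. \<xi> \<bullet> \<xi> + - r\<^sup>2)" "Ck_on k UNIV (\<lambda>\<xi>::'a. R\<^sup>2 + (-1) * (\<xi> \<bullet> \<xi>))" for k
    by (intro Ck_on_add Ck_on_mult Ck_on_norm_square Ck_on_const open_UNIV)+
  then show ?thesis
    unfolding annulus_bump_def
    by (intro Ck_on_mult Ck_on_max0_power open_UNIV) simp_all
qed

lemma annulus_bump_nonneg: "annulus_bump k r R \<xi> \<ge> 0"
  by (simp add: annulus_bump_def)

lemma annulus_bump_nonzero_iff:
  assumes "0 \<le> r" "0 \<le> R"
  shows "annulus_bump k r R \<xi> \<noteq> 0 \<longleftrightarrow> r < norm \<xi> \<and> norm \<xi> < R"
proof -
  have "r < norm \<xi> \<longleftrightarrow> r\<^sup>2 < \<xi> \<bullet> \<xi>" "norm \<xi> < R \<longleftrightarrow> \<xi> \<bullet> \<xi> < R\<^sup>2"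
    using assms abs_le_square_iff[of "norm \<xi>" r] abs_le_square_iff[of R "norm \<xi>"]
    by (auto simp: power2_norm_eq_inner[symmetric] not_le[symmetric])
  then show ?thesis by (auto simp: annulus_bump_def max_def not_less)
qed

text \<open>The part of the construction that only concerns a nonnegative function supported in an annulus whose support meets every dyadic
  orbit. It produces a function \<open>low_pass\<close> that is \<open>1\<close> near the origin, \<open>0\<close> far away, and whose dyadic
  differences are \<open>w\<close> divided by the orbit sum of \<open>w\<close>.\<close>

locale dyadic_bump =
  fixes w :: "'a::euclidean_space \<Rightarrow> real" and r R :: real and k :: nat
  assumes r: "0 < r" and w_nonneg: "w \<xi> \<ge> 0"
    and w_supp: "w \<xi> \<noteq> 0 \<Longrightarrow> r < norm \<xi> \<and> norm \<xi> < R"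
    and w_cover: "\<xi> \<noteq> 0 \<Longrightarrow> \<exists>j::int. w ((2 powi j :: real) *\<^sub>R \<xi>) \<noteq> 0"
    and w_Ck: "Ck_on k UNIV w"
begin

text \<open>The orbit sum is split at the scale of \<open>\<xi>\<close> itself, since the two halves are locally finite in different regions.
  \<open>above\<close> is discontinuous at the origin, where it vanishes although it equals the positive orbit sum at nearby points.\<close>

definition above :: "'a \<Rightarrow> real" where "above \<xi> = (\<Sum>i. w ((2::real) ^ i *\<^sub>R \<xi>))"

definition below :: "'a \<Rightarrow> real" where "below \<xi> = (\<Sum>i. w ((1/2::real) ^ Suc i *\<^sub>R \<xi>))"

lemma above_term_zero:
  assumes "R \<le> 2 ^ m * norm \<xi>" "m \<le> i"
  shows "w ((2::real) ^ i *\<^sub>R \<xi>) = 0"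
proof -
  have "(2::real) ^ m * norm \<xi> \<le> 2 ^ i * norm \<xi>"
    using assms(2) by (intro mult_right_mono power_increasing) auto
  then show ?thesis using w_supp[of "(2::real) ^ i *\<^sub>R \<xi>"] assms(1) by force
qed

lemma below_term_zero:
  assumes "(1/2) ^ Suc m * norm \<xi> \<le> r" "m \<le> i"
  shows "w ((1/2::real) ^ Suc i *\<^sub>R \<xi>) = 0"
proof -
  have "(1/2::real) ^ Suc i * norm \<xi> \<le> (1/2) ^ Suc m * norm \<xi>"
    using assms(2) by (intro mult_right_mono power_decreasing) auto
  then show ?thesis using w_supp[of "(1/2::real) ^ Suc i *\<^sub>R \<xi>"] assms(1) by force
qed

lemma above_index:
  assumes "\<rho> > 0" obtains m where "R \<le> 2 ^ m * \<rho>"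
proof -
  obtain m where "R / \<rho> < (2::real) ^ m" using real_arch_pow[of 2 "R / \<rho>"] by auto
  then have "R \<le> 2 ^ m * \<rho>" using assms by (simp add: divide_simps less_imp_le)
  then show ?thesis by (rule that)
qed

lemma below_index: obtains m where "(1/2) ^ Suc m * \<rho> \<le> r"
proof -
  obtain m where m: "\<bar>\<rho>\<bar> / r < (2::real) ^ m" using real_arch_pow[of 2 "\<bar>\<rho>\<bar> / r"] by auto
  then have "\<bar>\<rho>\<bar> < r * 2 ^ m" using r by (simp add: divide_simps mult.commute)
  also have "\<dots> \<le> r * 2 ^ Suc m" using r by simp
  finally have "\<bar>\<rho>\<bar> \<le> r * 2 ^ Suc m" by simp
  then have "\<rho> \<le> r * 2 ^ Suc m" by simp
  then show ?thesis using that[of m] by (simp add: power_one_over divide_simps)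
qed

lemma summable_above:
  assumes "\<xi> \<noteq> 0" shows "summable (\<lambda>i. w ((2::real) ^ i *\<^sub>R \<xi>))"
proof -
  obtain m where "R \<le> 2 ^ m * norm \<xi>" using above_index[of "norm \<xi>"] assms by auto
  then show ?thesis
    by (intro summable_finite[of "{..<m}"]) (auto simp: above_term_zero not_less)
qed

lemma summable_below: "summable (\<lambda>i. w ((1/2::real) ^ Suc i *\<^sub>R \<xi>))"
proof -
  obtain m where "(1/2) ^ Suc m * norm \<xi> \<le> r" using below_index[of "norm \<xi>"] .
  then show ?thesis
    by (intro summable_finite[of "{..<m}"]) (simp_all only: below_term_zero not_less lessThan_iff finite_lessThan)
qed

lemma above_double: "\<xi> \<noteq> 0 \<Longrightarrow> above \<xi> = w \<xi> + above (2 *\<^sub>R \<xi>)"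
  using suminf_split_head[OF summable_above] unfolding above_def by (simp add: mult.commute)

lemma below_double: "below (2 *\<^sub>R \<xi>) = w \<xi> + below \<xi>"
  using suminf_split_head[OF summable_below[of "2 *\<^sub>R \<xi>"]] unfolding below_def by simp

text \<open>Away from any ball around the origin only finitely many terms of the sum are nonzero.\<close>

lemma Ck_on_above: "Ck_on k (- {0}) above"
proof (rule Ck_on_locally)
  fix x :: 'a assume "x \<in> - {0}"
  then have x: "norm x / 2 > 0" by simp
  obtain m where m: "R \<le> 2 ^ m * (norm x / 2)" using above_index[OF x] .
  let ?T = "- cball (0 :: 'a) (norm x / 2)"
  have "Ck_on k ?T (\<lambda>\<xi>. \<Sum>i<m. w ((2::real) ^ i *\<^sub>R \<xi>))"
    by (intro Ck_on_sum Ck_on_scale[OF _ w_Ck]) auto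
  moreover have "(\<Sum>i<m. w ((2::real) ^ i *\<^sub>R \<xi>)) = above \<xi>" if "\<xi> \<in> ?T" for \<xi>
  proof -
    have "2 ^ m * (norm x / 2) \<le> 2 ^ m * norm \<xi>" using that by simp
    then have "R \<le> 2 ^ m * norm \<xi>" using m by linarith
    then show ?thesis unfolding above_def
      by (intro suminf_finite[symmetric]) (auto simp: above_term_zero)
  qed
  moreover have "open ?T" "x \<in> ?T" using x by (auto simp: open_Compl)
  ultimately have "Ck_on k ?T above" by (intro Ck_on_cong[where S="?T" and g=above])
  then show "\<exists>T. open T \<and> x \<in> T \<and> Ck_on k T above" using \<open>open ?T\<close> \<open>x \<in> ?T\<close> by (intro exI conjI)
qed

text \<open>On any ball around the origin only finitely many terms of the sum are nonzero.\<close>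

lemma Ck_on_below: "Ck_on k UNIV below"
proof (rule Ck_on_locally)
  fix x :: 'a
  obtain m where m: "(1/2) ^ Suc m * (norm x + 1) \<le> r" using below_index .
  let ?T = "ball (0 :: 'a) (norm x + 1)"
  have "Ck_on k ?T (\<lambda>\<xi>. \<Sum>i<m. w ((1/2::real) ^ Suc i *\<^sub>R \<xi>))"
    by (intro Ck_on_sum Ck_on_scale[OF _ w_Ck]) auto
  moreover have "(\<Sum>i<m. w ((1/2::real) ^ Suc i *\<^sub>R \<xi>)) = below \<xi>" if "\<xi> \<in> ?T" for \<xi>
  proof -
    have "(1/2::real) ^ Suc m * norm \<xi> \<le> (1/2) ^ Suc m * (norm x + 1)"
      using that by (intro mult_left_mono) auto
    then have "(1/2::real) ^ Suc m * norm \<xi> \<le> r" using m by linarith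
    then show ?thesis unfolding below_def
      by (intro suminf_finite[symmetric]) (simp_all only: below_term_zero not_less lessThan_iff finite_lessThan)
  qed
  moreover have "open ?T" "x \<in> ?T" by auto
  ultimately have "Ck_on k ?T below" by (intro Ck_on_cong[where S="?T" and g=below])
  then show "\<exists>T. open T \<and> x \<in> T \<and> Ck_on k T below" using \<open>open ?T\<close> \<open>x \<in> ?T\<close> by (intro exI conjI)
qed

definition total :: "'a \<Rightarrow> real" where "total \<xi> = above \<xi> + below \<xi>"

lemma total_double: "\<xi> \<noteq> 0 \<Longrightarrow> total (2 *\<^sub>R \<xi>) = total \<xi>"
  using above_double[of \<xi>] below_double[of \<xi>] unfolding total_def by simp

lemma total_pos:
  assumes "\<xi> \<noteq> 0" shows "total \<xi> > 0"
proof -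
  have nn: "above \<xi> \<ge> 0" "below \<xi> \<ge> 0"
    unfolding above_def below_def by (intro suminf_nonneg summable_above summable_below assms w_nonneg)+
  obtain j :: int where j: "w ((2 powi j :: real) *\<^sub>R \<xi>) \<noteq> 0" using w_cover[OF assms] by blast
  then have pos: "w ((2 powi j :: real) *\<^sub>R \<xi>) > 0" using w_nonneg less_eq_real_def by force
  show ?thesis
  proof (cases "j \<ge> 0")
    case True
    then have "w ((2::real) ^ nat j *\<^sub>R \<xi>) > 0" using pos by (simp add: power_int_def)
    then have "above \<xi> > 0" unfolding above_def
      by (intro suminf_pos2[where i="nat j"] summable_above assms w_nonneg)
    then show ?thesis using nn by (simp add: total_def)
  next
    case False
    then have eq: "(2 powi j :: real) = (1/2) ^ Suc (nat (- j) - 1)"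
      by (simp add: power_int_def power_one_over inverse_eq_divide)
    have "w ((1/2::real) ^ Suc (nat (- j) - 1) *\<^sub>R \<xi>) > 0" using pos unfolding eq .
    then have "below \<xi> > 0" unfolding below_def
      by (intro suminf_pos2[where i="nat (- j) - 1"] summable_below w_nonneg)
    then show ?thesis using nn by (simp add: total_def)
  qed
qed

lemma Ck_on_total: "Ck_on k (- {0}) total"
  unfolding total_def[abs_def] by (intro Ck_on_add Ck_on_above Ck_on_subset[OF Ck_on_below]) auto

text \<open>The quotient extends to the origin by the value \<open>1\<close>, because \<open>below\<close> vanishes near the origin and so
  \<open>above = total\<close> there.\<close>

definition low_pass :: "'a \<Rightarrow> real" where
  "low_pass \<xi> = (if \<xi> = 0 then 1 else above \<xi> / total \<xi>)"

lemma low_pass_near_0: "norm \<xi> \<le> r \<Longrightarrow> low_pass \<xi> = 1"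
proof -
  assume "norm \<xi> \<le> r"
  then have "w ((1/2::real) ^ Suc i *\<^sub>R \<xi>) = 0" for i
    using r by (intro below_term_zero[of 0]) auto
  then have "below \<xi> = 0" unfolding below_def by (simp only: suminf_zero)
  then show ?thesis using total_pos[of \<xi>] by (cases "\<xi> = 0") (auto simp: low_pass_def total_def)
qed

lemma low_pass_far: "norm \<xi> \<ge> R \<Longrightarrow> \<xi> \<noteq> 0 \<Longrightarrow> low_pass \<xi> = 0"
proof -
  assume *: "norm \<xi> \<ge> R" "\<xi> \<noteq> 0"
  then have "w ((2::real) ^ i *\<^sub>R \<xi>) = 0" for i by (intro above_term_zero[of 0]) auto
  then have "above \<xi> = 0" unfolding above_def by simp
  then show ?thesis using * by (simp add: low_pass_def)
qed

text \<open>The telescoping identity: the doubled orbit of \<open>\<xi>\<close> misses exactly the term \<open>w \<xi>\<close>, while the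
  denominator is unchanged.\<close>

lemma low_pass_double: "low_pass \<xi> - low_pass (2 *\<^sub>R \<xi>) = w \<xi> / total \<xi>"
proof (cases "\<xi> = 0")
  case True
  then show ?thesis using w_supp[of 0] r by (auto simp: low_pass_def)
next
  case False
  then show ?thesis using above_double[OF False] total_double[OF False]
    by (simp add: low_pass_def diff_divide_distrib[symmetric])
qed

lemma Ck_on_low_pass: "Ck_on k UNIV low_pass"
proof (rule Ck_on_locally)
  fix x :: 'a
  show "\<exists>T. open T \<and> x \<in> T \<and> Ck_on k T low_pass"
  proof (cases "x = 0")
    case True
    have "Ck_on k (ball 0 r) low_pass"
      by (rule Ck_on_cong[OF _ _ Ck_on_const[of _ _ 1]]) (auto simp: low_pass_near_0)
    then show ?thesis using True r by (intro exI[of _ "ball 0 r"]) auto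
  next
    case False
    have op: "open (- {0 :: 'a})" by (simp add: open_Compl)
    have ne: "total \<xi> \<noteq> 0" if "\<xi> \<in> - {0}" for \<xi> using total_pos[of \<xi>] that by auto
    have "Ck_on k (- {0}) low_pass"
      by (rule Ck_on_cong[OF op _ Ck_on_mult[OF op Ck_on_above Ck_on_inverse[OF op Ck_on_total ne]]])
         (auto simp: low_pass_def divide_inverse)
    then show ?thesis using False by (intro exI[of _ "- {0}"]) auto
  qed
qed

end

text \<open>The multipliers \<open>f\<eta> = \<chi> cnj m / S\<close> and \<open>f\<phi>\<close> of the introduction, where \<open>m\<close> is the Fourier transform of \<open>\<psi>\<close>. They arise from the
  preceding construction with \<open>w = \<chi> |m|\<^sup>2 = (\<chi> cnj m) m\<close>, so that \<open>m\<close> divides the difference of consecutive low-pass filters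
  smoothly even at its zeros.\<close>

lemma tauberian_resolution:
  fixes \<psi> :: "real^'n \<Rightarrow> complex"
  assumes int: "integrable lebesgue \<psi>" and taub: "tauberian \<psi>" and Ck: "Ck_on k (- {0}) (fourier \<psi>)"
  obtains f\<eta> f\<phi> :: "real^'n \<Rightarrow> complex" and r R :: real
  where "0 < r" "r < R" "Ck_on k UNIV f\<eta>" "Ck_on k UNIV f\<phi>"
    "\<forall>\<xi>. f\<eta> \<xi> \<noteq> 0 \<longrightarrow> r < norm \<xi> \<and> norm \<xi> < R" "\<forall>\<xi>. R < norm \<xi> \<longrightarrow> f\<phi> \<xi> = 0" "f\<phi> 0 = 1"
    "\<forall>\<xi>. f\<eta> \<xi> * fourier \<psi> \<xi> = f\<phi> \<xi> - f\<phi> (2 *\<^sub>R \<xi>)"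
proof -
  obtain A B :: real where AB: "0 < A" "A \<le> B" and cover:
    "\<And>\<xi>. \<xi> \<noteq> 0 \<Longrightarrow> \<exists>j::int. A \<le> norm ((2 powi j :: real) *\<^sub>R \<xi>) \<and> norm ((2 powi j :: real) *\<^sub>R \<xi>) \<le> B
        \<and> fourier \<psi> ((2 powi j :: real) *\<^sub>R \<xi>) \<noteq> 0"
    using tauberian_annulus[OF continuous_fourier[OF int] taub] by blast
  define r R where "r = A / 2" and "R = 2 * B"
  have rR: "0 < r" "r < A" "B < R" "r < R" using AB by (auto simp: r_def R_def)
  let ?\<chi> = "annulus_bump k r R :: real^'n \<Rightarrow> real"
  define w where "w \<xi> = ?\<chi> \<xi> * (cmod (fourier \<psi> \<xi>))\<^sup>2" for \<xi>
  have \<chi>_iff: "?\<chi> \<xi> \<noteq> 0 \<longleftrightarrow> r < norm \<xi> \<and> norm \<xi> < R" for \<xi>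
    using rR by (intro annulus_bump_nonzero_iff) auto
  have op: "open (- {0 :: real^'n})" by (simp add: open_Compl)
  have bump_Ck: "Ck_on k (- {0}) ?\<chi>"
    by (rule Ck_on_subset[OF Ck_on_annulus_bump]) simp
  have cnj_Ck: "Ck_on k (- {0}) (\<lambda>\<xi>. cnj (fourier \<psi> \<xi>))"
    by (rule Ck_on_bounded_linear_compose[OF op bounded_linear_cnj Ck])
  \<comment> \<open>Regularity off the origin suffices for a function that vanishes near the origin.\<close>
  have Un: "\<exists>T. open T \<and> x \<in> T \<and> Ck_on k T F" if F: "Ck_on k (- {0}) F" "\<And>\<xi>. F \<xi> \<noteq> 0 \<Longrightarrow> r < norm \<xi>"
    for F :: "real^'n \<Rightarrow> 'c::real_normed_vector" and x
  proof (cases "x = 0")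
    case True
    have "0 = F \<xi>" if "\<xi> \<in> ball 0 r" for \<xi>
      using F(2)[of \<xi>] that by (cases "F \<xi> = 0") auto
    then have "Ck_on k (ball 0 r) F"
      by (intro Ck_on_cong[OF open_ball _ Ck_on_const[OF open_ball, of _ _ _ 0]])
    then show ?thesis using True rR by (intro exI[of _ "ball 0 r"]) auto
  next
    case False
    then show ?thesis using F(1) op by (intro exI[of _ "- {0}"]) auto
  qed
  interpret dyadic_bump w r R k
  proof
    show "Ck_on k UNIV w"
    proof (rule Ck_on_locally, rule Un)
      have "Ck_on k (- {0}) (\<lambda>\<xi>. ?\<chi> \<xi> * Re (fourier \<psi> \<xi> * cnj (fourier \<psi> \<xi>)))"
        by (rule Ck_on_mult[OF op bump_Ck
              Ck_on_bounded_linear_compose[OF op bounded_linear_Re Ck_on_mult[OF op Ck cnj_Ck]]])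
      also have "(\<lambda>\<xi>. ?\<chi> \<xi> * Re (fourier \<psi> \<xi> * cnj (fourier \<psi> \<xi>))) = w"
        by (simp add: w_def fun_eq_iff complex_mult_cnj cmod_power2)
      finally show "Ck_on k (- {0}) w" .
      show "r < norm \<xi>" if "w \<xi> \<noteq> 0" for \<xi> using that \<chi>_iff[of \<xi>] by (auto simp: w_def)
    qed
    show "\<exists>j::int. w ((2 powi j :: real) *\<^sub>R \<xi>) \<noteq> 0" if "\<xi> \<noteq> 0" for \<xi>
    proof -
      obtain j :: int where j: "A \<le> norm ((2 powi j :: real) *\<^sub>R \<xi>)" "norm ((2 powi j :: real) *\<^sub>R \<xi>) \<le> B"
        "fourier \<psi> ((2 powi j :: real) *\<^sub>R \<xi>) \<noteq> 0" using cover[OF \<open>\<xi> \<noteq> 0\<close>] by blast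
      then have "?\<chi> ((2 powi j :: real) *\<^sub>R \<xi>) \<noteq> 0" unfolding \<chi>_iff using rR by linarith
      with j(3) show ?thesis by (intro exI[of _ j]) (simp add: w_def)
    qed
    show "0 \<le> w \<xi>" for \<xi> by (simp add: w_def annulus_bump_nonneg)
    show "r < norm \<xi> \<and> norm \<xi> < R" if "w \<xi> \<noteq> 0" for \<xi>
      using that \<chi>_iff[of \<xi>] by (auto simp: w_def)
  qed (fact rR)
  define f\<eta> where "f\<eta> \<xi> = complex_of_real (?\<chi> \<xi> * inverse (total \<xi>)) * cnj (fourier \<psi> \<xi>)" for \<xi>
  define f\<phi> where "f\<phi> \<xi> = complex_of_real (low_pass \<xi>)" for \<xi>
  have ne: "total \<xi> \<noteq> 0" if "\<xi> \<in> - {0}" for \<xi> using total_pos[of \<xi>] that by auto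
  have supp: "r < norm \<xi> \<and> norm \<xi> < R" if "f\<eta> \<xi> \<noteq> 0" for \<xi>
    using that \<chi>_iff[of \<xi>] by (auto simp: f\<eta>_def)
  show thesis
  proof (rule that[OF rR(1,4)])
    have f\<eta>_Ck: "Ck_on k (- {0}) f\<eta>"
      unfolding f\<eta>_def
      by (rule Ck_on_mult[OF op Ck_on_bounded_linear_compose[OF op bounded_linear_of_real
            Ck_on_mult[OF op bump_Ck Ck_on_inverse[OF op Ck_on_total ne]]] cnj_Ck])
    show "Ck_on k UNIV f\<eta>"
      by (rule Ck_on_locally, rule Un[OF f\<eta>_Ck]) (simp add: supp)
    show "Ck_on k UNIV f\<phi>"
      unfolding f\<phi>_def by (rule Ck_on_bounded_linear_compose[OF open_UNIV bounded_linear_of_real Ck_on_low_pass])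
    show "f\<phi> 0 = 1" by (simp add: f\<phi>_def low_pass_def)
    show "\<forall>\<xi>. R < norm \<xi> \<longrightarrow> f\<phi> \<xi> = 0"
    proof (intro allI impI)
      fix \<xi> :: "real^'n" assume "R < norm \<xi>"
      moreover from this have "\<xi> \<noteq> 0" using rR by auto
      ultimately show "f\<phi> \<xi> = 0" using low_pass_far[of \<xi>] by (simp add: f\<phi>_def)
    qed
    show "\<forall>\<xi>. f\<eta> \<xi> * fourier \<psi> \<xi> = f\<phi> \<xi> - f\<phi> (2 *\<^sub>R \<xi>)"
    proof
      fix \<xi>
      have "f\<eta> \<xi> * fourier \<psi> \<xi> = complex_of_real (?\<chi> \<xi> * inverse (total \<xi>)) * (fourier \<psi> \<xi> * cnj (fourier \<psi> \<xi>))"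
        by (simp add: f\<eta>_def mult_ac)
      also have "\<dots> = complex_of_real (w \<xi> / total \<xi>)"
        unfolding complex_norm_square[symmetric] w_def by (simp add: divide_inverse mult_ac)
      finally show "f\<eta> \<xi> * fourier \<psi> \<xi> = f\<phi> \<xi> - f\<phi> (2 *\<^sub>R \<xi>)"
        unfolding f\<phi>_def by (simp only: low_pass_double[symmetric] of_real_diff)
    qed
    show "\<forall>\<xi>. f\<eta> \<xi> \<noteq> 0 \<longrightarrow> r < norm \<xi> \<and> norm \<xi> < R" using supp by blast
  qed
qed

section \<open>Approximate identities for functions of polynomial growth\<close>

text \<open>It suffices to look at the term with the smallest \<open>i\<close> such that \<open>t < 2\<^sup>i\<close>, for which \<open>2\<^sup>i \<le> 2 (1 + t)\<close>.\<close>

lemma inverse_power_le_dyadic_sum: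
  fixes t :: real
  assumes "t \<ge> 0"
  shows "ennreal (1 / (1 + t) ^ N) \<le> (\<Sum>i. ennreal (2 ^ N / (2 ^ i) ^ N) * indicator {..<2 ^ i} t)"
proof -
  obtain i0 where "t < 2 ^ i0" using real_arch_pow[of 2 t] by auto
  define i where "i = (LEAST i. t < 2 ^ i)"
  have i: "t < 2 ^ i" unfolding i_def by (rule LeastI[of _ i0]) fact
  have "2 ^ i \<le> 2 * (1 + t)"
  proof (cases i)
    case (Suc m)
    then have "\<not> t < 2 ^ m" using not_less_Least[of m "\<lambda>i. t < 2 ^ i"] by (simp add: i_def)
    then show ?thesis using Suc by simp
  qed (use assms in simp)
  then have "(2 ^ i) ^ N \<le> (2 * (1 + t)) ^ N" by (intro power_mono) auto
  also have "(2 * (1 + t)) ^ N = 2 ^ N * (1 + t) ^ N" by (rule power_mult_distrib)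
  finally have "1 / (1 + t) ^ N \<le> 2 ^ N / (2 ^ i) ^ N"
    using assms by (simp add: divide_simps)
  define f where "f i = ennreal (2 ^ N / (2 ^ i) ^ N) * indicator {..<2 ^ i} t" for i
  have "ennreal (1 / (1 + t) ^ N) \<le> f i"
    using i \<open>1 / (1 + t) ^ N \<le> _\<close> by (simp add: f_def ennreal_leI)
  also have "\<dots> \<le> (\<Sum>i. f i)"
    using sum_le_suminf[of f "{i}"] by simp
  finally show ?thesis by (simp add: f_def)
qed

text \<open>Integral bounds over balls, fed into the dyadic decomposition of the kernel. The ball of radius \<open>2\<^sup>i / s\<close> contributes, up to a
  constant factor, at most \<open>(a + b s\<^sup>-\<^sup>p)\<close> times the \<open>i\<close>-th power of \<open>2 powr (p + n - N)\<close>, so the series is dominated by a geometric one. The constant in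
  front does not depend on \<open>a\<close>, \<open>b\<close> and \<open>s\<close>: this uniformity turns the lemma into a convergence statement for large \<open>s\<close>.\<close>

lemma nn_integral_decaying_kernel_le:
  fixes u :: "'a::euclidean_space \<Rightarrow> ennreal" and K :: "'a \<Rightarrow> 'b::real_normed_vector"
    and a b p M s :: real and n N :: nat
  assumes [measurable]: "u \<in> borel_measurable borel"
    and K: "\<And>z. norm (K z) \<le> M / (1 + norm z) ^ N" and M: "M \<ge> 0"
    and u: "\<And>\<rho>. \<rho> > 0 \<Longrightarrow> (\<integral>\<^sup>+y. u y * indicator (ball x \<rho>) y \<partial>lborel) \<le> ennreal ((a + b * \<rho> powr p) * \<rho> ^ n)"
    and ab: "a \<ge> 0" "b \<ge> 0" and p: "0 \<le> p" "p + n < N" and s: "s > 0"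
  shows "(\<integral>\<^sup>+y. ennreal (s ^ n * norm (K (s *\<^sub>R (x - y)))) * u y \<partial>lborel)
    \<le> ennreal (M * 2 ^ N / (1 - 2 powr (p + n - N)) * (a + b * s powr (- p)))"
proof -
  define q where "q = 2 powr (p + n - N)"
  have q: "0 < q" "q < 1" unfolding q_def using p powr_less_mono[of "p + n - N" 0 2] by auto
  define c where "c i = s ^ n * M * (2 ^ N / (2 ^ i) ^ N)" for i :: nat
  have c_nn: "c i \<ge> 0" for i using s M by (simp add: c_def)
  have "(\<integral>\<^sup>+y. ennreal (s ^ n * norm (K (s *\<^sub>R (x - y)))) * u y \<partial>lborel) \<le>
      (\<integral>\<^sup>+y. (\<Sum>i. ennreal (c i) * (u y * indicator (ball x (2 ^ i / s)) y)) \<partial>lborel)"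
  proof (intro nn_integral_mono)
    fix y
    have ind: "indicator {..<2 ^ i} (norm (s *\<^sub>R (x - y))) = (indicator (ball x (2 ^ i / s)) y :: ennreal)" for i
    proof -
      have "norm (s *\<^sub>R (x - y)) = s * dist x y" using s by (simp only: norm_scaleR dist_norm abs_of_pos)
      then show ?thesis using s by (auto simp: indicator_def field_simps)
    qed
    have "ennreal (s ^ n * norm (K (s *\<^sub>R (x - y)))) \<le> ennreal (s ^ n * M * (1 / (1 + norm (s *\<^sub>R (x - y))) ^ N))"
      using mult_left_mono[OF K, of "s ^ n" "s *\<^sub>R (x - y)"] s by (intro ennreal_leI) (simp del: norm_scaleR)
    also have "\<dots> = ennreal (s ^ n * M) * ennreal (1 / (1 + norm (s *\<^sub>R (x - y))) ^ N)"
      using s M by (intro ennreal_mult) auto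
    also have "\<dots> \<le> ennreal (s ^ n * M) * (\<Sum>i. ennreal (2 ^ N / (2 ^ i) ^ N) * indicator {..<2 ^ i} (norm (s *\<^sub>R (x - y))))"
      by (intro mult_left_mono inverse_power_le_dyadic_sum) auto
    also have "\<dots> = (\<Sum>i. ennreal (c i) * indicator (ball x (2 ^ i / s)) y)"
    proof -
      have "ennreal (c i) = ennreal (s ^ n * M) * ennreal (2 ^ N / (2 ^ i) ^ N)" for i
        unfolding c_def using s M by (intro ennreal_mult) auto
      then show ?thesis unfolding ind by (simp only: mult.assoc ennreal_suminf_cmult)
    qed
    finally have "ennreal (s ^ n * norm (K (s *\<^sub>R (x - y)))) * u y \<le>
        (\<Sum>i. ennreal (c i) * indicator (ball x (2 ^ i / s)) y) * u y"
      by (intro mult_right_mono) auto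
    also have "\<dots> = (\<Sum>i. ennreal (c i) * (u y * indicator (ball x (2 ^ i / s)) y))"
      by (subst ennreal_suminf_multc[symmetric]) (simp add: mult_ac)
    finally show "ennreal (s ^ n * norm (K (s *\<^sub>R (x - y)))) * u y \<le>
        (\<Sum>i. ennreal (c i) * (u y * indicator (ball x (2 ^ i / s)) y))" .
  qed
  also have "\<dots> = (\<Sum>i. ennreal (c i) * (\<integral>\<^sup>+y. u y * indicator (ball x (2 ^ i / s)) y \<partial>lborel))"
  proof -
    have meas: "(\<lambda>y. u y * indicator (ball x (2 ^ i / s)) y) \<in> borel_measurable lborel" for i
      by (intro borel_measurable_times_ennreal borel_measurable_indicator) auto
    have "(\<lambda>y. ennreal (c i) * (u y * indicator (ball x (2 ^ i / s)) y)) \<in> borel_measurable lborel" for i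
      by (intro borel_measurable_times_ennreal meas) auto
    then show ?thesis by (simp only: nn_integral_suminf nn_integral_cmult[OF meas])
  qed
  also have "\<dots> \<le> (\<Sum>i. ennreal (M * 2 ^ N * (a + b * s powr (- p)) * q ^ i))"
  proof (intro suminf_le summableI)
    fix i
    let ?\<rho> = "2 ^ i / s"
    have "ennreal (c i) * (\<integral>\<^sup>+y. u y * indicator (ball x ?\<rho>) y \<partial>lborel) \<le>
        ennreal (c i) * ennreal ((a + b * ?\<rho> powr p) * ?\<rho> ^ n)"
      using s by (intro mult_left_mono u) auto
    also have "\<dots> = ennreal (c i * ((a + b * ?\<rho> powr p) * ?\<rho> ^ n))"
      by (rule ennreal_mult[symmetric]) (use ab s c_nn in auto)
    also have "\<dots> \<le> ennreal (M * 2 ^ N * (a + b * s powr (- p)) * q ^ i)"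
    proof (rule ennreal_leI)
      have pw: "?\<rho> powr p = (2 ^ i) powr p * s powr (- p)"
        using s by (simp add: powr_divide powr_minus_divide)
      have one: "1 \<le> ((2::real) ^ i) powr p" using p by (intro ge_one_powr_ge_zero) auto
      have qi: "q ^ i = (2 ^ i) powr p * (2 ^ i) ^ n / (2 ^ i) ^ N"
      proof -
        have "q ^ i = 2 powr ((p + n - N) * i)" unfolding q_def by (simp add: powr_powr[symmetric] powr_realpow)
        also have "(p + n - N) * i = real i * p + real (i * n) - real (i * N)" by (simp add: algebra_simps)
        also have "2 powr \<dots> = 2 powr (real i * p) * 2 powr real (i * n) / 2 powr real (i * N)"
          by (simp only: powr_add powr_diff)
        also have "2 powr (real i * p) = ((2::real) ^ i) powr p" by (simp add: powr_powr[symmetric] powr_realpow)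
        also have "2 powr real (i * n) = ((2::real) ^ i) ^ n" by (simp only: powr_realpow zero_less_numeral power_mult)
        also have "2 powr real (i * N) = ((2::real) ^ i) ^ N" by (simp only: powr_realpow zero_less_numeral power_mult)
        finally show ?thesis .
      qed
      have "c i * ((a + b * ?\<rho> powr p) * ?\<rho> ^ n) =
          M * 2 ^ N * (a + b * s powr (- p) * (2 ^ i) powr p) * ((2 ^ i) ^ n / (2 ^ i) ^ N)"
        unfolding c_def pw using s by (simp add: field_simps)
      also have "\<dots> \<le> M * 2 ^ N * ((a + b * s powr (- p)) * (2 ^ i) powr p) * ((2 ^ i) ^ n / (2 ^ i) ^ N)"
      proof (intro mult_right_mono mult_left_mono)
        have "a * 1 \<le> a * (2 ^ i) powr p" using one ab by (intro mult_left_mono) auto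
        then show "a + b * s powr (- p) * (2 ^ i) powr p \<le> (a + b * s powr (- p)) * (2 ^ i) powr p"
          by (simp add: distrib_right)
      qed (use M in auto)
      also have "\<dots> = M * 2 ^ N * (a + b * s powr (- p)) * q ^ i" unfolding qi by simp
      finally show "c i * ((a + b * ?\<rho> powr p) * ?\<rho> ^ n) \<le> M * 2 ^ N * (a + b * s powr (- p)) * q ^ i" .
    qed
    finally show "ennreal (c i) * (\<integral>\<^sup>+y. u y * indicator (ball x ?\<rho>) y \<partial>lborel) \<le>
        ennreal (M * 2 ^ N * (a + b * s powr (- p)) * q ^ i)" .
  qed
  also have "\<dots> = ennreal (\<Sum>i. M * 2 ^ N * (a + b * s powr (- p)) * q ^ i)"
    using q ab M by (intro suminf_ennreal2 summable_mult summable_geometric) auto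
  also have "(\<Sum>i. M * 2 ^ N * (a + b * s powr (- p)) * q ^ i) = M * 2 ^ N * (a + b * s powr (- p)) * (1 / (1 - q))"
    using q by (subst suminf_mult) (auto simp: suminf_geometric summable_geometric)
  finally show ?thesis unfolding q_def by (simp add: mult_ac)
qed

text \<open>For radii below some \<open>d\<close> the Lebesgue point property gives the term with \<open>e\<close>. For larger radii the
  polynomial growth bounds the integral by a power of the radius, and \<open>\<rho> / d \<ge> 1\<close> allows all lower powers
  to be absorbed into \<open>\<rho> powr p\<close>.\<close>

lemma lebesgue_point_ball_integral_le:
  fixes g :: "'a::euclidean_space \<Rightarrow> 'b::{real_normed_vector, second_countable_topology}"
    and l p C R e :: real
  assumes [measurable]: "g \<in> borel_measurable borel"
    and fin: "\<And>R. (\<integral>\<^sup>+x. ennreal (norm (g x)) * indicator (ball 0 R) x \<partial>lborel) < \<infinity>"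
    and growth: "AE y in lborel. R \<le> norm y \<longrightarrow> norm (g y) \<le> C * norm y powr l" and C: "C \<ge> 0"
    and l: "0 \<le> l" "l \<le> p"
    and leb: "\<forall>e>0. \<exists>d>0. \<forall>r. 0 < r \<and> r < d \<longrightarrow>
      (\<integral>\<^sup>+y. ennreal (norm (g y - g x)) * indicator (ball x r) y \<partial>lborel) \<le> ennreal e * emeasure lborel (ball x r)"
    and e: "e > 0"
  obtains b where "b \<ge> 0" "\<And>\<rho>. \<rho> > 0 \<Longrightarrow>
     (\<integral>\<^sup>+y. ennreal (norm (g y - g x)) * indicator (ball x \<rho>) y \<partial>lborel) \<le> ennreal ((e + b * \<rho> powr p) * \<rho> ^ DIM('a))"
proof -
  let ?n = "DIM('a)"
  define \<omega> where "\<omega> = unit_ball_vol (real ?n)"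
  have \<omega>: "\<omega> > 0" by (simp add: \<omega>_def)
  have vol: "emeasure lborel (ball x \<rho>) = ennreal (\<omega> * \<rho> ^ ?n)" if "\<rho> > 0" for \<rho>
    using that by (simp add: emeasure_ball \<omega>_def)
  obtain d where d: "d > 0" "\<And>r. 0 < r \<Longrightarrow> r < d \<Longrightarrow>
     (\<integral>\<^sup>+y. ennreal (norm (g y - g x)) * indicator (ball x r) y \<partial>lborel) \<le> ennreal (e / \<omega>) * emeasure lborel (ball x r)"
    using leb e \<omega> by (metis divide_pos_pos)
  let ?J = "\<integral>\<^sup>+x. ennreal (norm (g x)) * indicator (ball 0 R) x \<partial>lborel"
  define I where "I = enn2real ?J"
  have I: "?J = ennreal I" "I \<ge> 0" using fin[of R] by (auto simp: I_def)
  define b where "b = I / (d ^ ?n * d powr p) + C * (norm x / d + 1) powr l * d powr l / d powr p * \<omega> + norm (g x) * \<omega> / d powr p"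
  have b: "b \<ge> 0" unfolding b_def using I(2) C \<omega> d(1) by simp
  show thesis
  proof (rule that[OF b])
    fix \<rho> :: real assume \<rho>: "\<rho> > 0"
    show "(\<integral>\<^sup>+y. ennreal (norm (g y - g x)) * indicator (ball x \<rho>) y \<partial>lborel) \<le> ennreal ((e + b * \<rho> powr p) * \<rho> ^ ?n)"
    proof (cases "\<rho> < d")
      case True
      have "(\<integral>\<^sup>+y. ennreal (norm (g y - g x)) * indicator (ball x \<rho>) y \<partial>lborel) \<le> ennreal (e / \<omega>) * ennreal (\<omega> * \<rho> ^ ?n)"
        using d(2)[OF \<rho> True] vol[OF \<rho>] by simp
      also have "\<dots> = ennreal (e * \<rho> ^ ?n)"
        using e \<omega> \<rho> by (subst ennreal_mult[symmetric]) auto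
      also have "\<dots> \<le> ennreal ((e + b * \<rho> powr p) * \<rho> ^ ?n)"
        using b \<rho> by (intro ennreal_leI mult_right_mono) auto
      finally show ?thesis .
    next
      case False
      define c where "c = C * (norm x + \<rho>) powr l + norm (g x)"
      have c: "c \<ge> 0" using C by (simp add: c_def)
      have "(\<integral>\<^sup>+y. ennreal (norm (g y - g x)) * indicator (ball x \<rho>) y \<partial>lborel) \<le>
          (\<integral>\<^sup>+y. ennreal (norm (g y)) * indicator (ball 0 R) y + ennreal c * indicator (ball x \<rho>) y \<partial>lborel)"
      proof (rule nn_integral_mono_AE, use growth in eventually_elim)
        fix y assume gr: "R \<le> norm y \<longrightarrow> norm (g y) \<le> C * norm y powr l"
        have tri: "norm (g y - g x) \<le> norm (g y) + norm (g x)" by (rule norm_triangle_ineq4)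
        show "ennreal (norm (g y - g x)) * indicator (ball x \<rho>) y \<le>
          ennreal (norm (g y)) * indicator (ball 0 R) y + ennreal c * indicator (ball x \<rho>) y"
        proof (cases "y \<in> ball x \<rho>")
          case True
          have "norm y \<le> norm x + norm (y - x)" using norm_triangle_ineq[of x "y - x"] by simp
          then have "norm y \<le> norm x + \<rho>" using True by (simp add: dist_norm norm_minus_commute)
          then have gr2: "C * norm y powr l \<le> C * (norm x + \<rho>) powr l"
            using C l by (intro mult_left_mono powr_mono2) auto
          have "norm (g y - g x) \<le> (if norm y < R then norm (g y) else 0) + c"
          proof (cases "norm y < R")
            case True
            have "norm (g x) \<le> c" using C by (simp add: c_def)
            then show ?thesis using tri True by simp
          next
            case False
            then show ?thesis using gr gr2 tri unfolding c_def by simp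
          qed
          then have "ennreal (norm (g y - g x)) \<le> ennreal (if norm y < R then norm (g y) else 0) + ennreal c"
            using c by (subst ennreal_plus[symmetric]) (auto intro!: ennreal_leI simp del: ennreal_plus)
          then show ?thesis using True by (auto simp: indicator_def)
        qed auto
      qed
      also have "\<dots> = ?J + ennreal c * emeasure lborel (ball x \<rho>)"
        by (subst nn_integral_add)
           (auto simp: nn_integral_cmult_indicator intro!: borel_measurable_times_ennreal borel_measurable_indicator)
      also have "\<dots> = ennreal (I + c * (\<omega> * \<rho> ^ ?n))"
        unfolding I(1) vol[OF \<rho>] using I(2) c \<omega> \<rho> by (simp add: ennreal_mult ennreal_plus)
      also have "\<dots> \<le> ennreal ((e + b * \<rho> powr p) * \<rho> ^ ?n)"
      proof (rule ennreal_leI)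
        \<comment> \<open>All lower powers of the radius are compared with X, which is at least 1.\<close>
        define X where "X = (\<rho> / d) powr p"
        have \<rho>d: "1 \<le> \<rho> / d" using False d(1) by simp
        have X1: "1 \<le> X" unfolding X_def using \<rho>d l by (intro ge_one_powr_ge_zero) auto
        have Xl: "(\<rho> / d) powr l \<le> X" unfolding X_def using \<rho>d l by (intro powr_mono) auto
        have X: "\<rho> powr p = X * d powr p" unfolding X_def using \<rho> d(1) by (simp add: powr_divide)
        have "1 \<le> (\<rho> / d) ^ ?n" using \<rho>d by simp
        then have "1 * 1 \<le> X * (\<rho> / d) ^ ?n" using X1 by (intro mult_mono) auto
        then have t1: "I \<le> I / (d ^ ?n * d powr p) * \<rho> powr p * \<rho> ^ ?n"
          using I(2) mult_left_mono[of 1 "X * (\<rho> / d) ^ ?n" I] d(1) unfolding X by (simp add: power_divide mult_ac)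
        have "norm x + \<rho> \<le> (norm x / d + 1) * d * (\<rho> / d)"
        proof -
          have "norm x * 1 \<le> norm x * (\<rho> / d)" using \<rho>d by (intro mult_left_mono) auto
          then show ?thesis using d(1) by (simp add: field_simps)
        qed
        then have "(norm x + \<rho>) powr l \<le> ((norm x / d + 1) * d * (\<rho> / d)) powr l"
          using l \<rho> by (intro powr_mono2) auto
        also have "\<dots> = (norm x / d + 1) powr l * d powr l * (\<rho> / d) powr l"
          using d(1) \<rho> by (simp only: powr_mult)
        also have "\<dots> \<le> (norm x / d + 1) powr l * d powr l * X"
          using Xl by (intro mult_left_mono) auto
        finally have "C * (norm x + \<rho>) powr l \<le> C * ((norm x / d + 1) powr l * d powr l * X)"
          using C by (rule mult_left_mono)
        moreover have "norm (g x) * 1 \<le> norm (g x) * X" using X1 by (intro mult_left_mono) auto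
        ultimately have "c \<le> C * ((norm x / d + 1) powr l * d powr l * X) + norm (g x) * X"
          unfolding c_def by simp
        then have "c * (\<omega> * \<rho> ^ ?n) \<le> (C * ((norm x / d + 1) powr l * d powr l * X) + norm (g x) * X) * (\<omega> * \<rho> ^ ?n)"
          using \<omega> \<rho> by (intro mult_right_mono) auto
        also have "\<dots> = (C * (norm x / d + 1) powr l * d powr l / d powr p * \<omega> + norm (g x) * \<omega> / d powr p) * \<rho> powr p * \<rho> ^ ?n"
          unfolding X using d(1) by (simp add: field_simps)
        finally have "I + c * (\<omega> * \<rho> ^ ?n) \<le> b * \<rho> powr p * \<rho> ^ ?n"
          using t1 unfolding b_def by (simp add: distrib_right)
        also have "\<dots> \<le> (e + b * \<rho> powr p) * \<rho> ^ ?n" using e \<rho> by (intro mult_right_mono) auto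
        finally show "I + c * (\<omega> * \<rho> ^ ?n) \<le> (e + b * \<rho> powr p) * \<rho> ^ ?n" .
      qed
      finally show ?thesis .
    qed
  qed
qed

text \<open>As the dilates of \<open>\<phi>\<close> have integral \<open>1\<close>, the error at \<open>x\<close> is the convolution of the dilate with \<open>g - g x\<close>. By the kernel bound
  it is at most \<open>H (e + b s powr -p)\<close> with \<open>H\<close> independent of \<open>e\<close>; first \<open>e\<close> is chosen small and then the scale \<open>s\<close> large.
  The same bound shows that the convolution is absolutely convergent.\<close>

lemma approximate_identity_at_lebesgue_point:
  fixes g \<phi> :: "real^'n \<Rightarrow> complex" and p M :: real
  assumes g[measurable]: "g \<in> borel_measurable borel"
    and \<phi>: "continuous_on UNIV \<phi>" "integrable lebesgue \<phi>" "fourier \<phi> 0 = 1"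
    and decay: "\<And>z. norm (\<phi> z) \<le> M / (1 + norm z) ^ N" and M: "M \<ge> 0"
    and p: "0 < p" "p + CARD('n) < N"
    and pt: "\<And>e. e > 0 \<Longrightarrow> \<exists>b\<ge>0. \<forall>\<rho>>0.
      (\<integral>\<^sup>+y. ennreal (norm (g y - g x)) * indicator (ball x \<rho>) y \<partial>lborel) \<le> ennreal ((e + b * \<rho> powr p) * \<rho> ^ CARD('n))"
  shows "conv_defined (dilate j \<phi>) g x"
    and "(\<lambda>m. conv (dilate (k + int m) \<phi>) g x) \<longlonglongrightarrow> g x"
proof -
  define H where "H = M * 2 ^ N / (1 - 2 powr (p + real CARD('n) - real N))"
  have "p + real CARD('n) - real N < 0" using p by simp
  from powr_less_mono[OF this, of 2] have "2 powr (p + real CARD('n) - real N) < 1" by simp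
  then have H: "H \<ge> 0" unfolding H_def using M by simp
  let ?s = "\<lambda>j::int. 2 powi j :: real"
  let ?d = "\<lambda>j y. dilate j \<phi> (x - y)"
  have nd: "norm (?d j y) = ?s j ^ CARD('n) * norm (\<phi> (?s j *\<^sub>R (x - y)))" for j y
    by (simp add: dilate_def power_int_mult power_int_of_nat)
  have bound: "(\<integral>\<^sup>+y. ennreal (norm (?d j y * (g y - g x))) \<partial>lborel) \<le> ennreal (H * (e + b * ?s j powr (- p)))"
    if "e > 0" "b \<ge> 0" "\<forall>\<rho>>0. (\<integral>\<^sup>+y. ennreal (norm (g y - g x)) * indicator (ball x \<rho>) y \<partial>lborel)
        \<le> ennreal ((e + b * \<rho> powr p) * \<rho> ^ CARD('n))" for e b j
  proof -
    have "(\<integral>\<^sup>+y. ennreal (norm (?d j y * (g y - g x))) \<partial>lborel) =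
        (\<integral>\<^sup>+y. ennreal (?s j ^ CARD('n) * norm (\<phi> (?s j *\<^sub>R (x - y)))) * ennreal (norm (g y - g x)) \<partial>lborel)"
      unfolding norm_mult nd by (intro nn_integral_cong ennreal_mult) auto
    also have "\<dots> \<le> ennreal (H * (e + b * ?s j powr (- p)))"
      unfolding H_def
      by (rule nn_integral_decaying_kernel_le[OF _ decay M])
         (use that p in \<open>auto simp del: scaleR_diff_right\<close>)
    finally show ?thesis .
  qed
  have d_cont: "continuous_on UNIV (?d j)" for j
    unfolding dilate_def by (intro continuous_intros continuous_on_compose2[OF \<phi>(1)]) auto
  have d_int: "integrable lebesgue (?d j)" for j
    using integrable_lebesgue_affine[of "-1" "dilate j \<phi>" x] integrable_dilate[OF \<phi>(2)] by simp
  have d_one: "(LINT y|lebesgue. ?d j y) = 1" for j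
  proof -
    have "(LINT y|lebesgue. dilate j \<phi> y) = (LINT y|lebesgue. ?d j y)"
      using integral_lebesgue_affine[of "-1" "dilate j \<phi>" x] by simp
    also have "(LINT y|lebesgue. dilate j \<phi> y) = fourier (dilate j \<phi>) 0" by (simp add: fourier_def)
    finally show ?thesis using \<phi>(3) by (simp add: fourier_dilate)
  qed
  have diff_int: "integrable lebesgue (\<lambda>y. ?d j y * (g y - g x))" for j
  proof (rule integrable_lebesgueI, rule integrableI_bounded)
    obtain b where "b \<ge> 0" "\<forall>\<rho>>0. (\<integral>\<^sup>+y. ennreal (norm (g y - g x)) * indicator (ball x \<rho>) y \<partial>lborel)
        \<le> ennreal ((1 + b * \<rho> powr p) * \<rho> ^ CARD('n))" using pt[of 1] by auto
    from bound[OF _ this, of j]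
    show "(\<integral>\<^sup>+y. ennreal (norm (?d j y * (g y - g x))) \<partial>lborel) < \<infinity>"
      by (simp add: order_le_less_trans)
    show "(\<lambda>y. ?d j y * (g y - g x)) \<in> borel_measurable lborel"
      using borel_measurable_continuous_onI[OF d_cont[of j]] by measurable
  qed
  have split: "?d j y * g y = ?d j y * (g y - g x) + ?d j y * g x" for j y
    by (simp add: algebra_simps)
  show "conv_defined (dilate j \<phi>) g x" for j
    unfolding conv_defined_def split using diff_int d_int by (intro Bochner_Integration.integrable_add) auto
  have conv_eq: "conv (dilate j \<phi>) g x - g x = (LINT y|lebesgue. ?d j y * (g y - g x))" for j
  proof -
    have "conv (dilate j \<phi>) g x = (LINT y|lebesgue. ?d j y * (g y - g x)) + (LINT y|lebesgue. ?d j y * g x)"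
      unfolding conv_def split using diff_int d_int by (intro Bochner_Integration.integral_add) auto
    then show ?thesis using d_one[of j] by simp
  qed
  have conv_le: "norm (conv (dilate j \<phi>) g x - g x) \<le> H * (e + b * ?s j powr (- p))"
    if "e > 0" "b \<ge> 0" "\<forall>\<rho>>0. (\<integral>\<^sup>+y. ennreal (norm (g y - g x)) * indicator (ball x \<rho>) y \<partial>lborel)
        \<le> ennreal ((e + b * \<rho> powr p) * \<rho> ^ CARD('n))" for e b j
  proof -
    have "ennreal (norm (conv (dilate j \<phi>) g x - g x)) \<le> (\<integral>\<^sup>+y. ennreal (norm (?d j y * (g y - g x))) \<partial>lebesgue)"
      unfolding conv_eq by (rule integral_norm_bound_ennreal[OF diff_int])
    also have "\<dots> = (\<integral>\<^sup>+y. ennreal (norm (?d j y * (g y - g x))) \<partial>lborel)"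
      by (rule nn_integral_completion)
    also have "\<dots> \<le> ennreal (H * (e + b * ?s j powr (- p)))" by (rule bound[OF that])
    finally show ?thesis using H that by (subst (asm) ennreal_le_iff) auto
  qed
  show "(\<lambda>m. conv (dilate (k + int m) \<phi>) g x) \<longlonglongrightarrow> g x"
  proof (rule LIMSEQ_I)
    fix e' :: real assume "e' > 0"
    define e where "e = e' / (2 * (H + 1))"
    have e: "e > 0" "H * e < e' / 2"
      unfolding e_def using \<open>e' > 0\<close> H by (auto simp: field_simps)
    obtain b where b: "b \<ge> 0" "\<forall>\<rho>>0. (\<integral>\<^sup>+y. ennreal (norm (g y - g x)) * indicator (ball x \<rho>) y \<partial>lborel)
        \<le> ennreal ((e + b * \<rho> powr p) * \<rho> ^ CARD('n))" using pt[OF e(1)] by auto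
    have "filterlim (\<lambda>m. ?s (k + int m)) at_top sequentially"
    proof -
      have "filterlim (\<lambda>m. ?s k * 2 ^ m) at_top sequentially"
        by (intro filterlim_tendsto_pos_mult_at_top[OF tendsto_const]
            filterlim_at_infinity_imp_filterlim_at_top filterlim_realpow_sequentially_gt1) auto
      then show ?thesis by (simp add: power_int_add power_int_of_nat)
    qed
    then have "(\<lambda>m. ?s (k + int m) powr (- p)) \<longlonglongrightarrow> 0"
      using p by (intro tendsto_neg_powr) auto
    then have "(\<lambda>m. H * b * ?s (k + int m) powr (- p)) \<longlonglongrightarrow> H * b * 0" by (intro tendsto_intros)
    then have "\<forall>\<^sub>F m in sequentially. H * b * ?s (k + int m) powr (- p) < e' / 2"
      using \<open>e' > 0\<close> by (intro order_tendstoD(2)) auto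
    then obtain m0 where m0: "\<And>m. m \<ge> m0 \<Longrightarrow> H * b * ?s (k + int m) powr (- p) < e' / 2"
      by (auto simp: eventually_sequentially)
    show "\<exists>m0. \<forall>m\<ge>m0. norm (conv (dilate (k + int m) \<phi>) g x - g x) < e'"
    proof (intro exI[of _ m0] allI impI)
      fix m assume "m \<ge> m0"
      have "norm (conv (dilate (k + int m) \<phi>) g x - g x) \<le> H * (e + b * ?s (k + int m) powr (- p))"
        by (rule conv_le[OF e(1) b])
      also have "\<dots> = H * e + H * b * ?s (k + int m) powr (- p)" by (simp add: distrib_left)
      also have "\<dots> < e'" using e(2) m0[OF \<open>m \<ge> m0\<close>] by linarith
      finally show "norm (conv (dilate (k + int m) \<phi>) g x - g x) < e'" .
    qed
  qed
qed

text \<open>The kernel bound against the constant function \<open>1\<close>, whose integral over a ball is the volume.\<close>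

lemma integrable_of_decay:
  fixes F :: "real^'n \<Rightarrow> complex"
  assumes cont: "continuous_on UNIV F" and decay: "\<And>x. norm (F x) \<le> C / (1 + norm x) ^ k" and C: "C \<ge> 0"
    and k: "CARD('n) < k"
  shows "integrable lebesgue F"
proof (rule integrable_lebesgueI, rule integrableI_bounded)
  show "F \<in> borel_measurable lborel" using borel_measurable_continuous_onI[OF cont] by simp
  let ?K = "\<lambda>z. F (- z)" and ?\<omega> = "unit_ball_vol (real DIM(real^'n))"
  have "(\<integral>\<^sup>+y. ennreal (1 ^ CARD('n) * norm (?K (1 *\<^sub>R (0 - y)))) * 1 \<partial>lborel)
    \<le> ennreal (C * 2 ^ k / (1 - 2 powr (0 + real CARD('n) - real k)) * (?\<omega> + 0 * 1 powr (- (0::real))))"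
  proof (rule nn_integral_decaying_kernel_le[where N=k])
    show "norm (?K z) \<le> C / (1 + norm z) ^ k" for z using decay[of "- z"] by simp
    show "(\<integral>\<^sup>+y. 1 * indicator (ball (0::real^'n) \<rho>) y \<partial>lborel) \<le> ennreal ((?\<omega> + 0 * \<rho> powr 0) * \<rho> ^ CARD('n))"
      if "\<rho> > 0" for \<rho>
      using that emeasure_ball[of \<rho> "0 :: real^'n"] by simp
  qed (use C k in auto)
  then show "(\<integral>\<^sup>+x. ennreal (norm (F x)) \<partial>lborel) < \<infinity>" by (simp add: order_le_less_trans)
qed

text \<open>Dilation commutes with the inverse Fourier transform, up to inverting the scale.\<close>

lemma dilate_inverse_fourier:
  fixes f :: "real^'n \<Rightarrow> complex"
  shows "dilate j (\<lambda>x. fourier f (- x)) = (\<lambda>x. fourier (\<lambda>\<xi>. f ((2 powi (- j) :: real) *\<^sub>R \<xi>)) (- x))"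
proof
  fix x :: "real^'n"
  let ?c = "2 powi (- j) :: real"
  have "?c ^ CARD('n) *\<^sub>R fourier (\<lambda>\<xi>. f (?c *\<^sub>R \<xi>)) (?c *\<^sub>R y) = fourier f y" for y
    using fourier_affine[of ?c f 0 y] by simp
  from this[of "- ((2 powi j :: real) *\<^sub>R x)"]
  have "?c ^ CARD('n) *\<^sub>R fourier (\<lambda>\<xi>. f (?c *\<^sub>R \<xi>)) (?c *\<^sub>R (- ((2 powi j :: real) *\<^sub>R x))) = fourier f (- ((2 powi j :: real) *\<^sub>R x))" .
  moreover have "?c *\<^sub>R (- ((2 powi j :: real) *\<^sub>R x)) = - x" by (simp add: power_int_minus)
  ultimately have eq: "?c ^ CARD('n) *\<^sub>R fourier (\<lambda>\<xi>. f (?c *\<^sub>R \<xi>)) (- x) = fourier f (- ((2 powi j :: real) *\<^sub>R x))"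
    by (simp only:)
  have "(2 powi (j * int CARD('n)) :: real) * ?c ^ CARD('n) = 1"
    by (simp add: power_int_mult power_int_of_nat power_int_minus power_inverse)
  then show "dilate j (\<lambda>x. fourier f (- x)) x = fourier (\<lambda>\<xi>. f (?c *\<^sub>R \<xi>)) (- x)"
    unfolding dilate_def eq[symmetric] by (simp only: scaleR_scaleR scaleR_one)
qed

lemma conv_cong_AE:
  fixes g g' K :: "real^'n \<Rightarrow> complex"
  assumes K: "continuous_on UNIV K" and g: "g \<in> borel_measurable lebesgue" "g' \<in> borel_measurable lebesgue"
    and ae: "AE x in lebesgue. g x = g' x"
  shows "conv_defined K g x \<longleftrightarrow> conv_defined K g' x" and "conv K g x = conv K g' x"
proof -
  have "continuous_on UNIV (\<lambda>y. K (x - y))"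
    by (intro continuous_on_compose2[OF K] continuous_intros) auto
  note m = borel_measurable_lebesgue_continuous[OF this]
  have ae': "AE y in lebesgue. K (x - y) * g y = K (x - y) * g' y" using ae by eventually_elim simp
  show "conv_defined K g x \<longleftrightarrow> conv_defined K g' x"
    unfolding conv_defined_def by (intro integrable_cong_AE borel_measurable_times m g ae')
  show "conv K g x = conv K g' x"
    unfolding conv_def by (intro integral_cong_AE borel_measurable_times m g ae')
qed

lemma locally_L1_measurable:
  fixes g :: "real^'n \<Rightarrow> complex"
  assumes "locally_L1 g" shows "g \<in> borel_measurable lebesgue"
proof (rule borel_measurable_LIMSEQ_metric)
  show "(\<lambda>x. indicator (cball 0 (real m)) x *\<^sub>R g x) \<in> borel_measurable lebesgue" for m
  proof -
    have "g absolutely_integrable_on cball 0 (real m)" using assms by (simp add: locally_L1_def)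
    then show ?thesis unfolding set_integrable_def by (rule borel_measurable_integrable)
  qed
  show "(\<lambda>m. indicator (cball 0 (real m)) x *\<^sub>R g x) \<longlonglongrightarrow> g x" for x
  proof (rule tendsto_eventually)
    obtain m0 where "norm x \<le> real m0" using real_arch_simple by blast
    then show "\<forall>\<^sub>F m in sequentially. indicator (cball 0 (real m)) x *\<^sub>R g x = g x"
      by (intro eventually_sequentiallyI[of m0]) (auto simp: indicator_def)
  qed
qed

text \<open>Passes to a Borel representative of \<open>g\<close>, for which almost every point is a Lebesgue point and
  agrees with \<open>g\<close>; convolutions do not see the difference. The exponent \<open>p\<close> is chosen halfway between the growth \<open>l\<close> of \<open>g\<close>
  and the surplus decay \<open>N - n\<close> of \<open>\<phi>\<close>.\<close>

lemma AE_approximate_identity: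
  fixes g \<phi> :: "real^'n \<Rightarrow> complex" and l M :: real
  assumes g: "locally_L1 g" "growth_bigo l g" and l: "0 \<le> l"
    and \<phi>: "continuous_on UNIV \<phi>" "integrable lebesgue \<phi>" "fourier \<phi> 0 = 1"
    and decay: "\<And>z. norm (\<phi> z) \<le> M / (1 + norm z) ^ N" and M: "M \<ge> 0"
    and N: "l + CARD('n) < N"
  shows "AE x in lebesgue. (\<forall>j. conv_defined (dilate j \<phi>) g x) \<and> (\<lambda>m. conv (dilate (k + int m) \<phi>) g x) \<longlonglongrightarrow> g x"
proof -
  have g_meas: "g \<in> borel_measurable lebesgue" by (rule locally_L1_measurable[OF g(1)])
  obtain g' where g': "g' \<in> borel_measurable lborel" "AE x in lborel. g x = g' x"
    using completion_ex_borel_complex[OF g_meas] .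
  have g'b: "g' \<in> borel_measurable borel" using g'(1) by simp
  have ae: "AE x in lebesgue. g x = g' x" using g'(2) by (rule AE_completion)
  have g'_meas: "g' \<in> borel_measurable lebesgue" using g'(1) by (rule measurable_completion)
  have fin: "(\<integral>\<^sup>+x. ennreal (norm (g' x)) * indicator (ball 0 R) x \<partial>lborel) < \<infinity>" for R
  proof -
    have "(\<integral>\<^sup>+x. ennreal (norm (g' x)) * indicator (ball 0 R) x \<partial>lborel) =
        (\<integral>\<^sup>+x. ennreal (norm (g' x)) * indicator (ball 0 R) x \<partial>lebesgue)"
      by (rule nn_integral_completion[symmetric])
    also have "\<dots> \<le> (\<integral>\<^sup>+x. ennreal (norm (indicator (cball 0 R) x *\<^sub>R g x)) \<partial>lebesgue)"
      by (rule nn_integral_mono_AE, use ae in eventually_elim) (auto simp: indicator_def)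
    also have "\<dots> < \<infinity>"
    proof -
      have "g absolutely_integrable_on cball 0 R" using g(1) by (simp add: locally_L1_def)
      then show ?thesis unfolding set_integrable_def integrable_iff_bounded by blast
    qed
    finally show ?thesis .
  qed
  obtain C R where "AE x in lebesgue. norm x \<ge> R \<longrightarrow> cmod (g x) \<le> C * norm x powr l"
    using g(2) unfolding growth_bigo_def by blast
  then have "AE x in lborel. norm x \<ge> R \<longrightarrow> cmod (g x) \<le> C * norm x powr l"
    by (simp only: AE_completion_iff)
  with g'(2) have gr: "AE x in lborel. R \<le> norm x \<longrightarrow> cmod (g' x) \<le> max C 0 * norm x powr l"
  proof eventually_elim
    case (elim x)
    have "C * norm x powr l \<le> max C 0 * norm x powr l" by (intro mult_right_mono) auto
    then show ?case using elim by auto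
  qed
  \<comment> \<open>Strictly between l and N - n, so that it is admissible for both the growth and the decay.\<close>
  define p where "p = (l + (real N - real CARD('n))) / 2"
  have p: "l \<le> p" "0 < p" "p + CARD('n) < N" unfolding p_def using N l by (auto simp: field_simps)
  have "AE x in lborel. \<forall>e>0. \<exists>d>0. \<forall>r. 0 < r \<and> r < d \<longrightarrow>
    (\<integral>\<^sup>+y. ennreal (norm (g' y - g' x)) * indicator (ball x r) y \<partial>lborel) \<le> ennreal e * emeasure lborel (ball x r)"
    by (rule AE_lebesgue_point[OF g'b fin])
  from AE_completion[OF this] ae show ?thesis
  proof eventually_elim
    case (elim x)
    have pt: "\<exists>b\<ge>0. \<forall>\<rho>>0. (\<integral>\<^sup>+y. ennreal (norm (g' y - g' x)) * indicator (ball x \<rho>) y \<partial>lborel)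
        \<le> ennreal ((e + b * \<rho> powr p) * \<rho> ^ CARD('n))" if "e > 0" for e
    proof -
      obtain b where "b \<ge> 0" "\<And>\<rho>. \<rho> > 0 \<Longrightarrow> (\<integral>\<^sup>+y. ennreal (norm (g' y - g' x)) * indicator (ball x \<rho>) y \<partial>lborel)
        \<le> ennreal ((e + b * \<rho> powr p) * \<rho> ^ DIM(real^'n))"
        by (rule lebesgue_point_ball_integral_le[OF g'b fin gr _ l p(1) elim(1) \<open>e > 0\<close>]) auto
      then show ?thesis by (intro exI[of _ b]) simp
    qed
    have d: "continuous_on UNIV (dilate j \<phi>)" for j
      unfolding dilate_def by (intro continuous_intros continuous_on_compose2[OF \<phi>(1)]) auto
    have "conv_defined (dilate j \<phi>) g' x" for j
      by (rule approximate_identity_at_lebesgue_point(1)[OF g'b \<phi> decay M p(2,3)]) (rule pt)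
    then have defined: "conv_defined (dilate j \<phi>) g x" for j
      unfolding conv_cong_AE(1)[OF d g_meas g'_meas ae] .
    have "(\<lambda>m. conv (dilate (k + int m) \<phi>) g' x) \<longlonglongrightarrow> g' x"
      by (rule approximate_identity_at_lebesgue_point(2)[OF g'b \<phi> decay M p(2,3)]) (rule pt)
    then have "(\<lambda>m. conv (dilate (k + int m) \<phi>) g x) \<longlonglongrightarrow> g x"
      unfolding conv_cong_AE(2)[OF d g_meas g'_meas ae] elim(2) .
    with defined show ?case by blast
  qed
qed

section \<open>The reproducing formula\<close>

theorem proposition4p1:
  fixes \<psi> :: "real ^ 'n \<Rightarrow> complex" and l :: real
  assumes "l \<ge> 0"
    and "integrable lebesgue \<psi>"
    and "tauberian \<psi>"
    and "Ck_on (CARD('n) + 1 + nat \<lfloor>l\<rfloor>) (- {0}) (fourier \<psi>)"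
  shows "\<exists>\<eta> \<phi> :: real ^ 'n \<Rightarrow> complex.
    integrable lebesgue \<eta> \<and> integrable lebesgue \<phi> \<and>
    Ck_on (CARD('n) + 1 + nat \<lfloor>l\<rfloor>) UNIV (fourier \<eta>) \<and>
    Ck_on (CARD('n) + 1 + nat \<lfloor>l\<rfloor>) UNIV (fourier \<phi>) \<and>
    compact (fun_support (fourier \<phi>)) \<and>
    (\<exists>a b::real. 0 < a \<and> a < b \<and> fun_support (fourier \<eta>) \<subseteq> {\<xi>. a \<le> norm \<xi> \<and> norm \<xi> \<le> b}) \<and>
    (\<forall>g :: real ^ 'n \<Rightarrow> complex. locally_L1 g \<and> growth_bigo l g \<longrightarrow>
      (\<forall>k::int. AE x in lebesgue.
        conv_defined (dilate k \<phi>) g x \<and>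
        (\<forall>j>k. conv_defined (conv (dilate j \<eta>) (dilate j \<psi>)) g x) \<and>
        summable (\<lambda>i. conv (conv (dilate (k + 1 + int i) \<eta>) (dilate (k + 1 + int i) \<psi>)) g x) \<and>
        g x = conv (dilate k \<phi>) g x +
          (\<Sum>i. conv (conv (dilate (k + 1 + int i) \<eta>) (dilate (k + 1 + int i) \<psi>)) g x)))"
proof -
  define N where "N = CARD('n) + 1 + nat \<lfloor>l\<rfloor>"
  have N: "CARD('n) < N" "l + CARD('n) < N"
    using assms(1) real_of_int_floor_add_one_gt[of l] by (simp_all add: N_def add.commute)
  obtain f\<eta> f\<phi> :: "real^'n \<Rightarrow> complex" and r R :: real where rR: "0 < r" "r < R"
    and Ck: "Ck_on N UNIV f\<eta>" "Ck_on N UNIV f\<phi>"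
    and all: "\<forall>\<xi>. f\<eta> \<xi> \<noteq> 0 \<longrightarrow> r < norm \<xi> \<and> norm \<xi> < R" "\<forall>\<xi>. R < norm \<xi> \<longrightarrow> f\<phi> \<xi> = 0" "f\<phi> 0 = 1"
      "\<forall>\<xi>. f\<eta> \<xi> * fourier \<psi> \<xi> = f\<phi> \<xi> - f\<phi> (2 *\<^sub>R \<xi>)"
    by (rule tauberian_resolution[OF assms(2,3) assms(4)[folded N_def]]) (rule that)
  have \<eta>_supp: "r < norm \<xi> \<and> norm \<xi> < R" if "f\<eta> \<xi> \<noteq> 0" for \<xi> using all(1) that by blast
  have \<phi>_supp: "f\<phi> \<xi> = 0" if "R < norm \<xi>" for \<xi> using all(2) that by blast
  note \<phi>_0 = all(3) and tele = all(4)[rule_format]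
  have \<eta>_supp': "f\<eta> \<xi> = 0" if "R < norm \<xi>" for \<xi> using \<eta>_supp[of \<xi>] that by force
  note cont = Ck[THEN Ck_on_imp_continuous_on]
  have f_int: "integrable lebesgue f\<eta>" "integrable lebesgue f\<phi>"
    using integrable_lebesgueI[OF integrable_continuous_compact_support[of f\<eta> R, OF cont(1) \<eta>_supp']]
      integrable_lebesgueI[OF integrable_continuous_compact_support[of f\<phi> R, OF cont(2) \<phi>_supp]] by blast+
  obtain C\<eta> where C\<eta>: "C\<eta> \<ge> 0" "\<And>\<xi>. norm (fourier f\<eta> \<xi>) \<le> C\<eta> / (1 + norm \<xi>) ^ N"
    using fourier_decay[OF Ck(1) \<eta>_supp'] by blast
  obtain C\<phi> where C\<phi>: "C\<phi> \<ge> 0" "\<And>\<xi>. norm (fourier f\<phi> \<xi>) \<le> C\<phi> / (1 + norm \<xi>) ^ N"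
    using fourier_decay[OF Ck(2) \<phi>_supp] by blast
  have F_int: "integrable lebesgue (fourier f\<eta>)" "integrable lebesgue (fourier f\<phi>)"
    by (rule integrable_of_decay[OF continuous_fourier[OF f_int(1)] C\<eta>(2,1) N(1)],
        rule integrable_of_decay[OF continuous_fourier[OF f_int(2)] C\<phi>(2,1) N(1)])
  define \<eta> \<phi> where "\<eta> = (\<lambda>x. fourier f\<eta> (- x))" and "\<phi> = (\<lambda>x. fourier f\<phi> (- x))"
  have \<eta>\<phi>_int: "integrable lebesgue \<eta>" "integrable lebesgue \<phi>"
    unfolding \<eta>_def \<phi>_def
    using integrable_lebesgue_affine[of "-1" _ 0, OF _ F_int(1)] integrable_lebesgue_affine[of "-1" _ 0, OF _ F_int(2)] by simp_all
  have fourier_\<eta>: "fourier \<eta> = f\<eta>"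
    unfolding \<eta>_def using fourier_inversion[of f\<eta> R, OF cont(1) \<eta>_supp' F_int(1)] by blast
  have fourier_\<phi>: "fourier \<phi> = f\<phi>"
    unfolding \<phi>_def using fourier_inversion[of f\<phi> R, OF cont(2) \<phi>_supp F_int(2)] by blast
  have \<phi>_cont: "continuous_on UNIV \<phi>"
    unfolding \<phi>_def by (intro continuous_on_compose2[OF continuous_fourier[OF f_int(2)]] continuous_intros) auto
  have \<phi>_decay: "norm (\<phi> z) \<le> C\<phi> / (1 + norm z) ^ N" for z
    using C\<phi>(2)[of "- z"] by (simp add: \<phi>_def)
  have f\<phi>_scale: "integrable lebesgue (\<lambda>\<xi>. f\<phi> (c *\<^sub>R \<xi>))" if "c \<noteq> 0" for c
    using integrable_lebesgue_affine[OF that f_int(2), of 0] by simp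
  have f\<eta>_scale: "integrable lebesgue (\<lambda>\<xi>. f\<eta> (c *\<^sub>R \<xi>))" if "c \<noteq> 0" for c
    using integrable_lebesgue_affine[OF that f_int(1), of 0] by simp
  \<comment> \<open>The multiplier identity at frequency scale j, read on the side of functions.\<close>
  have block: "conv (dilate j \<eta>) (dilate j \<psi>) = (\<lambda>x. dilate j \<phi> x - dilate (j - 1) \<phi> x)" for j
  proof
    fix x
    let ?c = "2 powi (- j) :: real"
    have c1: "2 powi (- (j - 1)) = 2 * ?c"
      using power_int_add_1'[of "2::real" "- j"] by (simp add: add.commute)
    have "conv (dilate j \<eta>) (dilate j \<psi>) x = fourier (\<lambda>\<xi>. f\<eta> (?c *\<^sub>R \<xi>) * fourier (dilate j \<psi>) \<xi>) (- x)"
      unfolding \<eta>_def dilate_inverse_fourier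
      by (intro conv_fourier f\<eta>_scale integrable_dilate assms(2)) simp
    also have "(\<lambda>\<xi>. f\<eta> (?c *\<^sub>R \<xi>) * fourier (dilate j \<psi>) \<xi>) =
        (\<lambda>\<xi>. f\<phi> (?c *\<^sub>R \<xi>) - f\<phi> ((2 powi (- (j - 1))) *\<^sub>R \<xi>))"
      unfolding fourier_dilate tele c1 by simp
    also have "fourier \<dots> (- x) = dilate j \<phi> x - dilate (j - 1) \<phi> x"
      unfolding \<phi>_def dilate_inverse_fourier by (intro fourier_diff f\<phi>_scale) auto
    finally show "conv (dilate j \<eta>) (dilate j \<psi>) x = dilate j \<phi> x - dilate (j - 1) \<phi> x" .
  qed
  show ?thesis
  proof (rule exI[of _ \<eta>], rule exI[of _ \<phi>], intro conjI allI impI)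
    show "Ck_on (CARD('n) + 1 + nat \<lfloor>l\<rfloor>) UNIV (fourier \<eta>)" "Ck_on (CARD('n) + 1 + nat \<lfloor>l\<rfloor>) UNIV (fourier \<phi>)"
      unfolding fourier_\<eta> fourier_\<phi> N_def[symmetric] by (fact Ck)+
    have "fun_support f\<phi> \<subseteq> cball 0 R"
      unfolding fun_support_def by (rule closure_minimal) (use \<phi>_supp in \<open>force simp: not_less\<close>)+
    then show "compact (fun_support (fourier \<phi>))"
      unfolding fourier_\<phi> compact_eq_bounded_closed
      by (auto simp: fun_support_def intro: bounded_subset)
    have "closed {\<xi> :: real^'n. r \<le> norm \<xi> \<and> norm \<xi> \<le> R}"
      by (intro closed_Collect_conj closed_Collect_le continuous_intros)
    then have "fun_support f\<eta> \<subseteq> {\<xi>. r \<le> norm \<xi> \<and> norm \<xi> \<le> R}"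
      unfolding fun_support_def by (intro closure_minimal) (use \<eta>_supp in \<open>force simp: less_imp_le\<close>)+
    then show "\<exists>a b::real. 0 < a \<and> a < b \<and> fun_support (fourier \<eta>) \<subseteq> {\<xi>. a \<le> norm \<xi> \<and> norm \<xi> \<le> b}"
      unfolding fourier_\<eta> using rR by blast
  next
    fix g :: "real^'n \<Rightarrow> complex" and k :: int
    assume g: "locally_L1 g \<and> growth_bigo l g"
    have "AE x in lebesgue. (\<forall>j. conv_defined (dilate j \<phi>) g x) \<and> (\<lambda>m. conv (dilate (k + int m) \<phi>) g x) \<longlonglongrightarrow> g x"
      by (rule AE_approximate_identity[OF _ _ assms(1) \<phi>_cont \<eta>\<phi>_int(2) _ \<phi>_decay C\<phi>(1) N(2)])
         (use g fourier_\<phi> \<phi>_0 in auto)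
    then show "AE x in lebesgue.
        conv_defined (dilate k \<phi>) g x \<and>
        (\<forall>j>k. conv_defined (conv (dilate j \<eta>) (dilate j \<psi>)) g x) \<and>
        summable (\<lambda>i. conv (conv (dilate (k + 1 + int i) \<eta>) (dilate (k + 1 + int i) \<psi>)) g x) \<and>
        g x = conv (dilate k \<phi>) g x +
          (\<Sum>i. conv (conv (dilate (k + 1 + int i) \<eta>) (dilate (k + 1 + int i) \<psi>)) g x)"
    proof eventually_elim
      case (elim x)
      then have def: "integrable lebesgue (\<lambda>y. dilate j \<phi> (x - y) * g y)" for j
        by (simp add: conv_defined_def)
      have block_def: "conv_defined (conv (dilate j \<eta>) (dilate j \<psi>)) g x" for j
        unfolding block conv_defined_def left_diff_distrib by (intro Bochner_Integration.integrable_diff def)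
      have block_conv: "conv (conv (dilate j \<eta>) (dilate j \<psi>)) g x = conv (dilate j \<phi>) g x - conv (dilate (j - 1) \<phi>) g x" for j
        unfolding block conv_def left_diff_distrib by (intro Bochner_Integration.integral_diff def)
      let ?f = "\<lambda>m. conv (dilate (k + int m) \<phi>) g x"
      have "(\<lambda>i. ?f (Suc i) - ?f i) sums (g x - ?f 0)"
        using elim by (intro telescope_sums) auto
      also have "(\<lambda>i. ?f (Suc i) - ?f i) = (\<lambda>i. conv (conv (dilate (k + 1 + int i) \<eta>) (dilate (k + 1 + int i) \<psi>)) g x)"
        unfolding block_conv by (simp add: add_ac)
      finally have sums: "(\<lambda>i. conv (conv (dilate (k + 1 + int i) \<eta>) (dilate (k + 1 + int i) \<psi>)) g x) sums (g x - conv (dilate k \<phi>) g x)"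
        by simp
      show ?case
        using elim block_def sums_summable[OF sums] sums_unique[OF sums, symmetric] by auto
    qed
  qed (fact \<eta>\<phi>_int)+
qed

end
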